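(* For integers $n,k$ with $3\le k\le n$, let $f_v(n,k)$ be the minimum integer $f\ge n-1$ such that every connected graph $G$ with $|V(G)|=n$ and $|E(G)|\ge f$ satisfies $mvc(G)\ge k$. Then $$f_v(n,k)=\begin{cases} n-1 & \text{if } k=3,\\ n+\binom{k-2}{2} & \text{if } 4\le k\le n-2,\\ n-1+\binom{k-2}{2} & \text{if } n-1\le k\le n.\end{cases}$$
   Context: All graphs are simple, finite, undirected and connected. A path in a vertex-colored graph is vertex-monochromatic if all its internal vertices have the same color (in particular, a path with at most one internal vertex is vertex-monochromatic). A vertex-coloring (not required to be proper) of a connected graph $G$ is an MVC-coloring if any two vertices of $G$ are joined by a vertex-monochromatic path. The monochromatic vertex-connection number $mvc(G)$ is the maximum number of colors used in an MVC-coloring of $G$. By convention $\binom{a}{2}=a(a-1)/2$, so $\binom{1}{2}=0$. The cases of the formula are consistent where they overlap (when $k=3$ and $n\in\{3,4\}$). *)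

theory Defs
  imports Complex_Main
begin

text \<open>A graph is given by its vertex set \<open>V\<close> and its edge set \<open>E\<close>, the edges being
  two-element subsets of \<open>V\<close>.\<close>

definition simple_graph :: "'a set \<Rightarrow> 'a set set \<Rightarrow> bool" where
  "simple_graph V E \<longleftrightarrow> finite V \<and> (\<forall>e\<in>E. e \<subseteq> V \<and> card e = 2)"

definition path_between :: "'a set \<Rightarrow> 'a set set \<Rightarrow> 'a \<Rightarrow> 'a list \<Rightarrow> 'a \<Rightarrow> bool" where
  "path_between V E u p v \<longleftrightarrow>
     p \<noteq> [] \<and> distinct p \<and> set p \<subseteq> V \<and> successively (\<lambda>x y. {x, y} \<in> E) p \<and>
     hd p = u \<and> last p = v"

definition connected_graph :: "'a set \<Rightarrow> 'a set set \<Rightarrow> bool" where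
  "connected_graph V E \<longleftrightarrow>
     simple_graph V E \<and> V \<noteq> {} \<and> (\<forall>u\<in>V. \<forall>v\<in>V. \<exists>p. path_between V E u p v)"

definition internal_vertices :: "'a list \<Rightarrow> 'a set" where
  "internal_vertices p = set (butlast (tl p))"

definition vertex_monochromatic :: "('a \<Rightarrow> 'c) \<Rightarrow> 'a list \<Rightarrow> bool" where
  "vertex_monochromatic c p \<longleftrightarrow>
     (\<forall>x\<in>internal_vertices p. \<forall>y\<in>internal_vertices p. c x = c y)"

definition MVC_coloring :: "'a set \<Rightarrow> 'a set set \<Rightarrow> ('a \<Rightarrow> 'c) \<Rightarrow> bool" where
  "MVC_coloring V E c \<longleftrightarrow>
     (\<forall>u\<in>V. \<forall>v\<in>V. \<exists>p. path_between V E u p v \<and> vertex_monochromatic c p)"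

text \<open>Colors are natural numbers, which is no restriction for finite graphs. For a connected
  graph the set below is nonempty (constant colorings belong to it) and bounded by \<open>card V\<close>,
  so the maximum exists.\<close>

definition mvc :: "'a set \<Rightarrow> 'a set set \<Rightarrow> nat" where
  "mvc V E = Max {card (c ` V) | c :: 'a \<Rightarrow> nat. MVC_coloring V E c}"

text \<open>Every finite graph is isomorphic to one whose vertices are natural numbers, so it suffices
  to let \<open>V\<close> range over sets of naturals. A least \<open>f\<close> always exists, because the condition is
  vacuous once \<open>f\<close> exceeds \<open>n choose 2\<close>.\<close>

definition f_v :: "nat \<Rightarrow> nat \<Rightarrow> nat" where
  "f_v n k = (LEAST f. n - 1 \<le> f \<and>
     (\<forall>(V :: nat set) E. connected_graph V E \<and> card V = n \<and> f \<le> card E \<longrightarrow> k \<le> mvc V E))"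

end

theory Submission
  imports Defs
begin

text \<open>Write \<open>n\<close> and \<open>e\<close> for the numbers of vertices and edges. The number
  \<open>mvc\<close> is governed by connected vertex sets. If \<open>D\<close> is connected and
  \<open>b\<close> further vertices have a neighbour in \<open>D\<close>, then \<open>D\<close>
  grows to a connected dominating set with at least \<open>b\<close> vertices outside it; one
  colour inside and pairwise different colours outside give an MVC-coloring with more than
  \<open>b\<close> colours (\<open>boundary_mvc\<close>). In the language of trees: from three
  vertices on, \<open>mvc\<close> exceeds the number of leaves of every spanning tree.

  The main upper bound on \<open>f_v\<close> is therefore a theorem of Ding, Johnson and Seymour,
  \<open>edge_bound\<close>: if \<open>n \<ge> t + 3\<close> and no connected set has more
  than \<open>t\<close> outside neighbours, then \<open>e < n + (t choose 2)\<close>. It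
  is proved by induction on \<open>n\<close>. If \<open>n \<ge> t + 4\<close>, an edge that
  lies in no triangle can be contracted, so that every edge may be assumed to lie in a triangle.
  A connected set is grown from a vertex of maximal degree \<open>d\<close>, taking in a
  boundary vertex whenever this enlarges the boundary. The growth stalls at a set
  \<open>D\<close> with boundary \<open>B\<close>, \<open>|B| = b\<close>, such that every
  vertex of \<open>B\<close> has at most one neighbour in the set \<open>U\<close> of vertices
  not yet reached. Since each step gained at least one,
  \<open>|D| \<le> b - d + 1\<close>, and the degree bound \<open>d\<close> controls the
  edges that meet \<open>D \<union> B\<close>.

  If \<open>b < t\<close>, the components of \<open>U\<close> have to share the remaining gain
  \<open>t - b\<close>. A cruder edge bound without exceptional orders
  (\<open>edge_bound_all_orders\<close>), applied to each component, is enough because quadratic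
  functions are superadditive. If \<open>b = t\<close>, then \<open>U\<close> spans no edges
  (up to a small case of order \<open>t + 3\<close>), and the claim is that
  \<open>D \<union> B\<close> misses enough edges to pay for the edges between
  \<open>B\<close> and \<open>U\<close>. Two vertices of \<open>D \<union> B\<close> that are
  adjacent form a connected set, so its boundary is at most \<open>t\<close>; hence they have
  common non-neighbours, the more of them the more vertices of \<open>U\<close> they see. When
  \<open>D\<close> is a single vertex, this puts all vertices of \<open>B\<close> with a
  neighbour in \<open>U\<close> into one component of the complement, which then has at least as
  many edges as a tree, unless they all see the same vertex of \<open>U\<close>
  (\<open>hub_bound\<close>). Otherwise almost all vertices of \<open>D \<union> B\<close>
  have degree \<open>d\<close>, so that one of them has few non-neighbours, and these few cannot
  serve all the other vertices (\<open>spread_bound\<close>).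

  For \<open>k \<ge> n - 1\<close> the complement has so few edges that \<open>G\<close> has
  diameter at most two, when all vertices may get different colours, or (for
  \<open>k = n - 1\<close>) an edge dominates \<open>G\<close>. For \<open>k = 3\<close> a
  single vertex with two neighbours serves as the connected set.

  The lower bounds come from a cycle in which one vertex is replaced by a clique of
  \<open>k - 3\<close> twins (\<open>closed_necklace\<close>), with one edge removed when
  \<open>k \<ge> n - 1\<close> (\<open>open_necklace\<close>): following the monochromatic
  paths between distant vertices leaves at most two colours besides those of the clique.\<close>

section \<open>Graphs as relations: connectivity and edge counts\<close>

lemma maximal_subset:
  assumes "finite V" "P A" "\<And>B. P B \<Longrightarrow> B \<subseteq> V"
  obtains M where "P M" "\<And>B. P B \<Longrightarrow> M \<subseteq> B \<Longrightarrow> B = M"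
proof -
  have "finite {B. P B}" using assms by (auto intro: finite_subset[of _ "Pow V"])
  then obtain M where "M \<in> {B. P B}" "\<forall>B\<in>{B. P B}. M \<subseteq> B \<longrightarrow> M = B"
    using finite_has_maximal2[of "{B. P B}" A] assms(2) by auto
  then show ?thesis using that[of M] by auto
qed

locale adjacency =
  fixes adj :: "'a \<Rightarrow> 'a \<Rightarrow> bool"
  assumes adj_sym: "adj x y \<Longrightarrow> adj y x" and adj_irrefl: "\<not> adj x x"
begin

text \<open>Connectivity is expressed through cuts: gluing, growing and contracting connected sets then need
  no paths. Paths enter only when colourings do.\<close>

definition linked :: "'a set \<Rightarrow> bool" where
  "linked S \<longleftrightarrow> S \<noteq> {} \<and> (\<forall>X. X \<subseteq> S \<and> X \<noteq> {} \<and> X \<noteq> S \<longrightarrow> (\<exists>x\<in>X. \<exists>y\<in>S - X. adj x y))"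

definition boundary :: "'a set \<Rightarrow> 'a set \<Rightarrow> 'a set" where
  "boundary V D = {v \<in> V - D. \<exists>u\<in>D. adj u v}"

definition degree :: "'a set \<Rightarrow> 'a \<Rightarrow> nat" where
  "degree V v = card {u \<in> V. adj v u}"

text \<open>Twice the number of edges inside \<open>V\<close>: counting ordered pairs keeps the degree sums
  free of division.\<close>

definition darts :: "'a set \<Rightarrow> nat" where
  "darts V = (\<Sum>v\<in>V. degree V v)"

text \<open>The number of edges between \<open>A\<close> and \<open>B\<close> when these are disjoint.\<close>

definition joins :: "'a set \<Rightarrow> 'a set \<Rightarrow> nat" where
  "joins A B = (\<Sum>a\<in>A. degree B a)"

lemma linked_cut:
  assumes "linked S" "X \<subseteq> S" "X \<noteq> {}" "X \<noteq> S"
  obtains x y where "x \<in> X" "y \<in> S" "y \<notin> X" "adj x y"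
  using assms unfolding linked_def by (metis DiffE)

lemma linkedI:
  assumes "S \<noteq> {}"
    and "\<And>X. X \<subseteq> S \<Longrightarrow> X \<noteq> {} \<Longrightarrow> X \<noteq> S \<Longrightarrow> \<exists>x\<in>X. \<exists>y\<in>S - X. adj x y"
  shows "linked S"
  using assms unfolding linked_def by blast

lemma linked_nonempty: "linked S \<Longrightarrow> S \<noteq> {}"
  by (simp add: linked_def)

lemma linked_singleton: "linked {v}"
  unfolding linked_def by blast

lemma linked_Un:
  assumes A: "linked A" and B: "linked B" and ab: "a \<in> A" "b \<in> B" "a = b \<or> adj a b"
  shows "linked (A \<union> B)"
proof (rule linkedI)
  show "A \<union> B \<noteq> {}" using ab by blast
next
  fix X assume X: "X \<subseteq> A \<union> B" "X \<noteq> {}" "X \<noteq> A \<union> B"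
  consider "X \<inter> A \<noteq> {}" "X \<inter> A \<noteq> A" | "X \<inter> B \<noteq> {}" "X \<inter> B \<noteq> B"
    | "X \<inter> A = {}" "X \<inter> B = B" | "X \<inter> A = A" "X \<inter> B = {}"
    using X by blast
  then show "\<exists>x\<in>X. \<exists>y\<in>A \<union> B - X. adj x y"
  proof cases
    case 1
    then show ?thesis using linked_cut[OF A, of "X \<inter> A"] by blast
  next
    case 2
    then show ?thesis using linked_cut[OF B, of "X \<inter> B"] by blast
  next
    case 3
    then have "a \<notin> X" "b \<in> X" using ab by blast+
    then show ?thesis using ab adj_sym by blast
  next
    case 4
    then have "b \<notin> X" "a \<in> X" using ab by blast+
    then show ?thesis using ab by blast
  qed
qed

lemma linked_insert:
  assumes "linked D" "u \<in> D" "adj u y"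
  shows "linked (insert y D)"
  using linked_Un[OF assms(1) linked_singleton[of y], of u y] assms by simp

lemma linked_pair: "adj x y \<Longrightarrow> linked {x, y}"
  using linked_insert[OF linked_singleton[of x], of x y] by (simp add: insert_commute)

text \<open>A maximal connected subset containing \<open>u\<close> has no edge to the rest of
  \<open>U\<close>, as it could be enlarged along such an edge.\<close>

lemma component_exists:
  assumes "finite U" "u \<in> U"
  obtains C where "u \<in> C" "C \<subseteq> U" "linked C" "\<And>x y. x \<in> C \<Longrightarrow> y \<in> U - C \<Longrightarrow> \<not> adj x y"
proof -
  obtain C where C: "u \<in> C \<and> C \<subseteq> U \<and> linked C"
    and max: "\<And>B. u \<in> B \<and> B \<subseteq> U \<and> linked B \<Longrightarrow> C \<subseteq> B \<Longrightarrow> B = C"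
    using maximal_subset[of U "\<lambda>B. u \<in> B \<and> B \<subseteq> U \<and> linked B" "{u}"] assms linked_singleton
    by auto
  have "\<not> adj x y" if "x \<in> C" "y \<in> U - C" for x y
  proof
    assume "adj x y"
    then have "insert y C = C" using C that linked_insert by (intro max) auto
    then show False using that by blast
  qed
  then show ?thesis using that C by blast
qed

lemma degree_eq_sum: "finite V \<Longrightarrow> degree V v = (\<Sum>u\<in>V. of_bool (adj v u))"
  unfolding degree_def by (simp add: Int_def)

lemma degree_Un: "finite A \<Longrightarrow> finite B \<Longrightarrow> A \<inter> B = {} \<Longrightarrow> degree (A \<union> B) v = degree A v + degree B v"
  by (simp only: degree_eq_sum finite_Un sum.union_disjoint)

lemma degree_mono: "finite B \<Longrightarrow> A \<subseteq> B \<Longrightarrow> degree A v \<le> degree B v"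
  unfolding degree_def by (rule card_mono) auto

lemma joins_commute: "finite A \<Longrightarrow> finite B \<Longrightarrow> joins A B = joins B A"
proof -
  assume fin: "finite A" "finite B"
  have "joins A B = (\<Sum>a\<in>A. \<Sum>b\<in>B. of_bool (adj a b))"
    unfolding joins_def by (rule sum.cong[OF refl]) (rule degree_eq_sum[OF fin(2)])
  also have "\<dots> = (\<Sum>b\<in>B. \<Sum>a\<in>A. of_bool (adj a b))" by (rule sum.swap)
  also have "\<dots> = (\<Sum>b\<in>B. \<Sum>a\<in>A. of_bool (adj b a))"
    by (intro sum.cong refl arg_cong[of _ _ of_bool]) (blast intro: adj_sym)
  also have "\<dots> = joins B A"
    unfolding joins_def by (rule sum.cong[OF refl]) (rule degree_eq_sum[OF fin(1), symmetric])
  finally show ?thesis .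
qed

lemma joins_self: "joins V V = darts V"
  by (simp add: joins_def darts_def)

lemma joins_Un_left:
  "finite A \<Longrightarrow> finite B \<Longrightarrow> A \<inter> B = {} \<Longrightarrow> joins (A \<union> B) C = joins A C + joins B C"
  by (simp add: joins_def sum.union_disjoint)

lemma joins_Un_right:
  "finite B \<Longrightarrow> finite C \<Longrightarrow> B \<inter> C = {} \<Longrightarrow> joins A (B \<union> C) = joins A B + joins A C"
  by (simp add: joins_def degree_Un sum.distrib)

lemma darts_Un:
  assumes "finite A" "finite B" "A \<inter> B = {}"
  shows "darts (A \<union> B) = darts A + darts B + 2 * joins A B"
proof -
  have "darts (A \<union> B) = joins A A + joins A B + (joins B A + joins B B)"
    using assms by (simp add: joins_self[symmetric] joins_Un_left joins_Un_right)
  then show ?thesis using assms joins_commute[of A B] by (simp add: joins_self)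
qed

lemma darts_insert:
  assumes "finite V" "v \<notin> V"
  shows "darts (insert v V) = darts V + 2 * degree V v"
proof -
  have "darts {v} = 0" by (simp add: darts_def degree_def adj_irrefl)
  moreover have "joins {v} V = degree V v" by (simp add: joins_def)
  ultimately show ?thesis using darts_Un[of "{v}" V] assms by simp
qed

lemma darts_mono: "finite B \<Longrightarrow> A \<subseteq> B \<Longrightarrow> darts A \<le> darts B"
  unfolding darts_def by (rule order_trans[OF sum_mono[OF degree_mono] sum_mono2]) auto

lemma even_darts: "finite V \<Longrightarrow> even (darts V)"
proof (induction V rule: finite_induct)
  case empty
  then show ?case by (simp add: darts_def)
next
  case (insert x F)
  then show ?case by (simp add: darts_insert)
qed

lemma joins_eq_0: "finite B \<Longrightarrow> (\<And>a b. a \<in> A \<Longrightarrow> b \<in> B \<Longrightarrow> \<not> adj a b) \<Longrightarrow> joins A B = 0"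
  unfolding joins_def degree_def by (rule sum.neutral) auto

text \<open>A connected graph has at least as many edges as a tree: a vertex set that has this many is
  enlarged across a cut by a vertex that brings at least one edge.\<close>

lemma darts_linked_ge:
  assumes fin: "finite C" and C: "linked C"
  shows "2 * card C \<le> darts C + 2"
proof -
  obtain c where c: "c \<in> C" using C linked_nonempty by blast
  obtain A where A: "A \<noteq> {} \<and> A \<subseteq> C \<and> 2 * card A \<le> darts A + 2"
    and max: "\<And>B. B \<noteq> {} \<and> B \<subseteq> C \<and> 2 * card B \<le> darts B + 2 \<Longrightarrow> A \<subseteq> B \<Longrightarrow> B = A"
    using maximal_subset[of C "\<lambda>A. A \<noteq> {} \<and> A \<subseteq> C \<and> 2 * card A \<le> darts A + 2" "{c}"] fin c
    by auto
  have "A = C"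
  proof (rule ccontr)
    assume "A \<noteq> C"
    then obtain x y where xy: "x \<in> A" "y \<in> C" "y \<notin> A" "adj x y"
      using A linked_cut[OF C, of A] by blast
    have finA: "finite A" using A fin finite_subset by blast
    have "{x} \<subseteq> {u \<in> A. adj y u}" using xy adj_sym by blast
    then have "card {x} \<le> degree A y" unfolding degree_def using finA by (intro card_mono) auto
    then have "insert y A = A" using A xy finA by (intro max) (auto simp: darts_insert)
    then show False using xy by blast
  qed
  then show ?thesis using A by blast
qed

section \<open>Growing connected sets\<close>

lemma finite_boundary: "finite V \<Longrightarrow> finite (boundary V D)"
  unfolding boundary_def by simp

lemma boundary_singleton: "boundary V {v} = {u \<in> V. adj v u}"
  unfolding boundary_def using adj_irrefl by auto

lemma card_boundary_singleton: "card (boundary V {v}) = degree V v"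
  by (simp add: boundary_singleton degree_def)

text \<open>The vertices that a connected set \<open>D\<close> has not reached yet.\<close>

definition fresh :: "'a set \<Rightarrow> 'a set \<Rightarrow> 'a set" where
  "fresh V D = V - D - boundary V D"

lemma finite_fresh: "finite V \<Longrightarrow> finite (fresh V D)"
  unfolding fresh_def by simp

lemma fresh_not_adj: "d \<in> D \<Longrightarrow> z \<in> fresh V D \<Longrightarrow> \<not> adj d z"
  unfolding fresh_def boundary_def by auto

lemma boundary_insert:
  "y \<in> boundary V D \<Longrightarrow>
   boundary V (insert y D) = (boundary V D - {y}) \<union> {z \<in> fresh V D. adj y z}"
  unfolding boundary_def fresh_def using adj_irrefl by auto

text \<open>When \<open>y\<close> joins \<open>D\<close>, the boundary loses \<open>y\<close> and wins its
  unreached neighbours; so a step loses nothing as soon as \<open>y\<close> has one such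
  neighbour.\<close>

lemma card_boundary_insert:
  assumes "finite V" "y \<in> boundary V D"
  shows "card (boundary V (insert y D)) + 1 = card (boundary V D) + degree (fresh V D) y"
proof -
  have "card (boundary V (insert y D)) = card (boundary V D - {y}) + card {z \<in> fresh V D. adj y z}"
    unfolding boundary_insert[OF assms(2)]
    using assms finite_boundary finite_fresh by (intro card_Un_disjoint) (auto simp: fresh_def)
  moreover have "card (boundary V D - {y}) + 1 = card (boundary V D)"
    using assms finite_boundary by (metis Suc_eq_plus1 card_Suc_Diff1)
  ultimately show ?thesis by (simp add: degree_def)
qed

lemma linked_insert_boundary:
  "linked D \<Longrightarrow> y \<in> boundary V D \<Longrightarrow> linked (insert y D)"
  unfolding boundary_def using linked_insert by blast

lemma fresh_reached:
  assumes V: "linked V" and D: "D \<subseteq> V" "D \<noteq> {}" and X: "X \<subseteq> fresh V D" "X \<noteq> {}"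
  obtains x y where "x \<in> X" "y \<in> V - X" "y \<notin> D" "adj x y"
proof -
  have "X \<noteq> V" "X \<subseteq> V" using D X unfolding fresh_def by auto
  then obtain x y where xy: "x \<in> X" "y \<in> V" "y \<notin> X" "adj x y"
    using linked_cut[OF V, of X] X by blast
  have "y \<notin> D" using xy X fresh_not_adj adj_sym by blast
  then show ?thesis using that xy by blast
qed

lemma fresh_neighbour:
  assumes V: "linked V" and D: "D \<subseteq> V" "D \<noteq> {}" and ne: "fresh V D \<noteq> {}"
  obtains y z where "y \<in> boundary V D" "z \<in> fresh V D" "adj y z"
proof -
  obtain x y where "x \<in> fresh V D" "y \<in> V - fresh V D" "y \<notin> D" "adj x y"
    using fresh_reached[OF V D subset_refl ne] by blast
  then show ?thesis using that[of y x] adj_sym unfolding fresh_def by blast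
qed

text \<open>As long as some vertex is unreached, a boundary vertex with an unreached neighbour can be taken
  in without shrinking the boundary.\<close>

lemma dominating_extension:
  assumes fin: "finite V" and V: "linked V" and D: "linked D" "D \<subseteq> V"
  obtains D' where "D \<subseteq> D'" "D' \<subseteq> V" "linked D'" "V - D' = boundary V D'"
    "card (boundary V D) \<le> card (boundary V D')"
proof -
  let ?P = "\<lambda>A. D \<subseteq> A \<and> A \<subseteq> V \<and> linked A \<and> card (boundary V D) \<le> card (boundary V A)"
  obtain A where A: "?P A" and max: "\<And>B. ?P B \<Longrightarrow> A \<subseteq> B \<Longrightarrow> B = A"
    using maximal_subset[of V ?P D] fin D by auto
  have "fresh V A = {}"
  proof (rule ccontr)
    assume "fresh V A \<noteq> {}"
    moreover have "A \<noteq> {}" using A linked_nonempty by blast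
    ultimately obtain y z where yz: "y \<in> boundary V A" "z \<in> fresh V A" "adj y z"
      using fresh_neighbour[OF V, of A] A by blast
    have "{z} \<subseteq> {u \<in> fresh V A. adj y u}" using yz by blast
    then have "card {z} \<le> degree (fresh V A) y"
      unfolding degree_def using finite_fresh[OF fin] by (intro card_mono) auto
    then have "card (boundary V A) \<le> card (boundary V (insert y A))"
      using card_boundary_insert[OF fin yz(1)] by simp
    moreover have "insert y A \<subseteq> V" using A yz unfolding boundary_def by blast
    moreover have "linked (insert y A)" using A yz linked_insert_boundary by simp
    ultimately have "insert y A = A" using A by (intro max) auto
    then have "y \<in> A" by blast
    then show False using yz unfolding boundary_def by blast
  qed
  then have "V - A = boundary V A" unfolding fresh_def boundary_def by blast
  then show ?thesis using that A by blast
qed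

text \<open>If growth from \<open>z\<close> never has more than one way to go on, the graph is a path that
  starts at \<open>z\<close>. The induction removes \<open>z\<close> and continues from its only
  neighbour.\<close>

lemma path_like:
  assumes "finite V" "linked V" "z \<in> V"
    and "\<And>D. linked D \<Longrightarrow> z \<in> D \<Longrightarrow> D \<subseteq> V \<Longrightarrow> card (boundary V D) \<le> 1"
  shows "darts V + 2 \<le> 2 * card V"
  using assms
proof (induction "card V" arbitrary: V z)
  case 0
  then show ?case by auto
next
  case (Suc m)
  show ?case
  proof (cases "V = {z}")
    case True
    then show ?thesis by (simp add: darts_def degree_def adj_irrefl)
  next
    case False
    then obtain z' where z': "z' \<in> V" "z' \<noteq> z" "adj z z'"
      using linked_cut[OF Suc.prems(2), of "{z}"] Suc.prems(3) by blast
    let ?W = "V - {z}"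
    have "card {u \<in> V. adj z u} \<le> 1"
      using Suc.prems(4)[of "{z}"] linked_singleton Suc.prems(3) by (simp add: boundary_singleton)
    then have only: "u = z'" if "u \<in> V" "adj z u" for u
      using that z' Suc.prems(1) card_le_Suc0_iff_eq[of "{u \<in> V. adj z u}"] by auto
    have W: "linked ?W"
    proof (rule linkedI)
      show "?W \<noteq> {}" using z' by blast
    next
      fix X assume X: "X \<subseteq> ?W" "X \<noteq> {}" "X \<noteq> ?W"
      show "\<exists>x\<in>X. \<exists>y\<in>?W - X. adj x y"
      proof (cases "z' \<in> X")
        case True
        have "?W - X \<subseteq> V" "?W - X \<noteq> {}" "?W - X \<noteq> V" using X Suc.prems(3) by blast+
        then obtain x y where xy: "x \<in> ?W - X" "y \<in> V" "y \<notin> ?W - X" "adj x y"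
          using linked_cut[OF Suc.prems(2)] by metis
        have "y \<noteq> z" using xy only[of x] adj_sym[of x y] True by blast
        then show ?thesis using xy adj_sym by blast
      next
        case False
        then obtain x y where xy: "x \<in> X" "y \<in> V" "y \<notin> X" "adj x y"
          using linked_cut[OF Suc.prems(2), of X] X Suc.prems(3) by blast
        have "y \<noteq> z" using xy only[of x] adj_sym[of x y] False X by blast
        then show ?thesis using xy by blast
      qed
    qed
    have "card (boundary ?W D) \<le> 1" if D: "linked D" "z' \<in> D" "D \<subseteq> ?W" for D
    proof -
      have "linked (insert z D)" using linked_insert D z' adj_sym by blast
      moreover have "boundary V (insert z D) = boundary ?W D"
        unfolding boundary_def using D only by blast
      ultimately show ?thesis using Suc.prems(4)[of "insert z D"] D Suc.prems(3) by auto
    qed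
    moreover have "m = card ?W" using Suc.hyps(2) Suc.prems(3) by simp
    ultimately have "darts ?W + 2 \<le> 2 * card ?W"
      using Suc.hyps(1)[of ?W z'] Suc.prems(1) W z' by blast
    moreover have "degree ?W z = 1"
    proof -
      have "{u \<in> ?W. adj z u} = {z'}" using only z' by blast
      then show ?thesis by (simp add: degree_def)
    qed
    moreover have "darts V = darts ?W + 2 * degree ?W z"
      using darts_insert[of ?W z] Suc.prems by (simp add: insert_absorb)
    ultimately show ?thesis using Suc.hyps(2) Suc.prems(3) \<open>m = card ?W\<close> by linarith
  qed
qed

end


section \<open>An edge bound for all orders\<close>

lemma best_subset:
  fixes f :: "'a set \<Rightarrow> nat"
  assumes "finite V" "P A" "\<And>B. P B \<Longrightarrow> B \<subseteq> V"
  obtains M where "P M" "\<And>B. P B \<Longrightarrow> f B \<le> f M"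
proof -
  have "finite {B. P B}" using assms by (auto intro: finite_subset[of _ "Pow V"])
  then have fin: "finite (f ` {B. P B})" by simp
  have "Max (f ` {B. P B}) \<in> f ` {B. P B}" using fin assms(2) by (intro Max_in) auto
  then obtain M where "P M" "f M = Max (f ` {B. P B})" by auto
  then show ?thesis using that[of M] fin by simp
qed

context adjacency
begin

text \<open>Since boundaries need not shrink while a connected set grows to a dominating one, this says for
  connected \<open>V\<close> that no spanning tree has more than \<open>t\<close> leaves (apart
  from graphs with one or two vertices). Quantifying over all connected sets instead of spanning
  trees makes the condition easy to transfer to subgraphs and contractions.\<close>

definition few_leaves :: "'a set \<Rightarrow> nat \<Rightarrow> bool" where
  "few_leaves V t \<longleftrightarrow> (\<forall>D. linked D \<and> D \<subseteq> V \<longrightarrow> card (boundary V D) \<le> t)"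

lemma few_leavesD: "few_leaves V t \<Longrightarrow> linked D \<Longrightarrow> D \<subseteq> V \<Longrightarrow> card (boundary V D) \<le> t"
  unfolding few_leaves_def by blast

lemma few_leaves_degree: "few_leaves V t \<Longrightarrow> v \<in> V \<Longrightarrow> degree V v \<le> t"
  using few_leavesD[of V t "{v}"] linked_singleton by (simp add: card_boundary_singleton)

text \<open>A connected set that avoids the root can be grown to a dominating one; the root is then on its
  boundary and can be added at the price of one boundary vertex.\<close>

lemma few_leaves_rooted:
  assumes fin: "finite C" and C: "linked C" and z: "z \<in> C"
    and rooted: "\<And>D. linked D \<Longrightarrow> z \<in> D \<Longrightarrow> D \<subseteq> C \<Longrightarrow> card (boundary C D) \<le> m"
  shows "few_leaves C (m + 1)"
  unfolding few_leaves_def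
proof (intro allI impI)
  fix D assume D: "linked D \<and> D \<subseteq> C"
  then obtain E where E: "D \<subseteq> E" "E \<subseteq> C" "linked E" "C - E = boundary C E"
    "card (boundary C D) \<le> card (boundary C E)"
    using dominating_extension[OF fin C] by blast
  show "card (boundary C D) \<le> m + 1"
  proof (cases "z \<in> E")
    case True
    then show ?thesis using rooted[of E] E by simp
  next
    case False
    then have z': "z \<in> boundary C E" using E z by blast
    then have "card (boundary C (insert z E)) \<le> m"
      using rooted[of "insert z E"] E z linked_insert_boundary by blast
    then show ?thesis using card_boundary_insert[OF fin z'] E by linarith
  qed
qed

text \<open>Among the connected sets whose boundary outweighs their size by at least as much as for
  \<open>{r}\<close>, a maximal one cannot contain a boundary vertex with two unreached
  neighbours, since adding it would preserve the inequality.\<close>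

lemma stalled_tree_exists:
  assumes fin: "finite V" and r: "r \<in> V"
  obtains D where "linked D" "D \<subseteq> V" "card D + degree V r \<le> card (boundary V D) + 1"
    "\<And>y. y \<in> boundary V D \<Longrightarrow> degree (fresh V D) y \<le> 1"
proof -
  let ?P = "\<lambda>D. linked D \<and> D \<subseteq> V \<and> card D + degree V r \<le> card (boundary V D) + 1"
  have "?P {r}" using r linked_singleton by (simp add: card_boundary_singleton)
  then obtain D where D: "?P D" and max: "\<And>B. ?P B \<Longrightarrow> D \<subseteq> B \<Longrightarrow> B = D"
    using maximal_subset[of V ?P "{r}"] fin by blast
  have "degree (fresh V D) y \<le> 1" if y: "y \<in> boundary V D" for y
  proof (rule ccontr)
    assume "\<not> ?thesis"
    then have "card (boundary V D) + 1 \<le> card (boundary V (insert y D))"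
      using card_boundary_insert[OF fin y] by linarith
    moreover have "y \<notin> D" "y \<in> V" using y unfolding boundary_def by auto
    moreover have "finite D" using D fin finite_subset by blast
    ultimately have "?P (insert y D)" using D y linked_insert_boundary by auto
    then have "insert y D = D" by (rule max) blast
    then show False using \<open>y \<notin> D\<close> by blast
  qed
  then show ?thesis using that D by blast
qed

lemma boundary_fresh_partition:
  assumes "D \<subseteq> V"
  shows "V = (D \<union> boundary V D) \<union> fresh V D" "(D \<union> boundary V D) \<inter> fresh V D = {}"
    "D \<inter> boundary V D = {}"
  using assms unfolding fresh_def boundary_def by auto

lemma joins_fresh:
  assumes "finite V" "D \<subseteq> V"
  shows "joins (D \<union> boundary V D) (fresh V D) = joins (boundary V D) (fresh V D)"
proof -
  have "joins D (fresh V D) = 0"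
    using assms finite_fresh fresh_not_adj by (intro joins_eq_0) auto
  then show ?thesis
    using assms boundary_fresh_partition[OF assms(2)] finite_boundary finite_subset
    by (subst joins_Un_left) auto
qed

text \<open>Edges that meet \<open>D\<close> or its boundary are bounded by degrees. Unreached vertices have
  neighbours only on the boundary and among themselves.\<close>

lemma darts_le_by_tree:
  assumes fin: "finite V" and D: "D \<subseteq> V" and deg: "\<And>v. v \<in> V \<Longrightarrow> degree V v \<le> d"
  shows "darts V \<le> (card D + card (boundary V D)) * d
                     + joins (boundary V D) (fresh V D) + darts (fresh V D)"
proof -
  let ?K = "D \<union> boundary V D" and ?U = "fresh V D"
  note part = boundary_fresh_partition[OF D]
  have finK: "finite ?K" "finite ?U" "finite D"
    using fin D finite_boundary finite_fresh finite_subset by auto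
  have "darts V = joins (?K \<union> ?U) V" using part(1) joins_self by simp
  also have "\<dots> = joins ?K V + joins ?U V" using finK part by (intro joins_Un_left) auto
  also have "joins ?U V = joins ?U (?K \<union> ?U)" using part(1) by simp
  also have "\<dots> = joins ?K ?U + darts ?U"
    using finK part joins_commute[of ?U ?K] by (subst joins_Un_right) (auto simp: joins_self)
  finally have "darts V = joins ?K V + (joins (boundary V D) ?U + darts ?U)"
    using joins_fresh[OF fin D] by simp
  moreover have "joins ?K V \<le> card ?K * d"
    unfolding joins_def using sum_bounded_above[of ?K "degree V" d] deg D
    by (auto simp: boundary_def)
  moreover have "card ?K = card D + card (boundary V D)"
    using finK part(3) finite_boundary[OF fin] by (intro card_Un_disjoint) auto
  ultimately show ?thesis by simp
qed

lemma joins_le_card: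
  assumes "\<And>y. y \<in> B \<Longrightarrow> degree U y \<le> 1"
  shows "joins B U \<le> card B"
  unfolding joins_def using sum_bounded_above[of B "degree U" 1] assms by simp

text \<open>Let every connected set containing \<open>D\<close> have a boundary of at most \<open>q\<close>
  more vertices than \<open>D\<close>. Then the components of the unreached part share this
  gain: a component that can be grown from its contact \<open>z\<close> to a boundary of
  \<open>m\<close> vertices uses up \<open>m - 1\<close> of it, the loss of one being the
  boundary vertex \<open>y\<close> through which the component is entered. The bound
  \<open>q\<^sup>2 + 4 * q\<close> is superadditive in \<open>q\<close>, so the components
  can be removed one at a time.\<close>

lemma darts_fresh_le:
  assumes "finite V" "D \<subseteq> V" "linked D"
    and "\<And>X. X \<subseteq> fresh V D \<Longrightarrow> X \<noteq> {} \<Longrightarrow> \<exists>x\<in>X. \<exists>y\<in>V - X. adj x y"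
    and "\<And>E. linked E \<Longrightarrow> D \<subseteq> E \<Longrightarrow> E \<subseteq> V \<Longrightarrow> card (boundary V E) \<le> card (boundary V D) + q"
    and "\<And>C m. C \<subseteq> fresh V D \<Longrightarrow> linked C \<Longrightarrow> 2 \<le> m \<Longrightarrow> few_leaves C m \<Longrightarrow>
                darts C + 4 \<le> 2 * card C + m\<^sup>2"
  shows "darts (fresh V D) \<le> 2 * card (fresh V D) + q\<^sup>2 + 4 * q \<and>
         (q = 0 \<and> fresh V D \<noteq> {} \<longrightarrow> darts (fresh V D) + 2 \<le> 2 * card (fresh V D))"
  using assms
proof (induction "card (fresh V D)" arbitrary: V q rule: less_induct)
  case less
  note fin = less.prems(1) and D = less.prems(2,3) and reach = less.prems(4)
    and grow = less.prems(5) and small = less.prems(6)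
  let ?U = "fresh V D"
  show ?case
  proof (cases "?U = {}")
    case True
    then show ?thesis by (simp add: darts_def)
  next
    case False
    then obtain u where "u \<in> ?U" by blast
    then obtain C where C: "u \<in> C" "C \<subseteq> ?U" "linked C"
      and sep: "\<And>x y. x \<in> C \<Longrightarrow> y \<in> ?U - C \<Longrightarrow> \<not> adj x y"
      using component_exists[OF finite_fresh[OF fin]] by blast
    have finC: "finite C" using C finite_fresh[OF fin] finite_subset by blast
    have CV: "C \<subseteq> V" "C \<inter> D = {}" "C \<inter> boundary V D = {}" using C unfolding fresh_def by auto
    obtain z y where zy: "z \<in> C" "y \<in> V - C" "adj z y"
      using reach[of C] C by blast
    have yB: "y \<in> boundary V D"
      using zy sep[of z y] C fresh_not_adj[of y D z V] adj_sym[of z y] unfolding fresh_def by blast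
    obtain E1 where E1: "linked E1 \<and> z \<in> E1 \<and> E1 \<subseteq> C"
      and best: "\<And>E. linked E \<and> z \<in> E \<and> E \<subseteq> C \<Longrightarrow> card (boundary C E) \<le> card (boundary C E1)"
      using best_subset[of C "\<lambda>E. linked E \<and> z \<in> E \<and> E \<subseteq> C" "{z}" "\<lambda>E. card (boundary C E)"]
        finC zy linked_singleton by auto
    \<comment> \<open>Truncated subtraction is right here: a component with a single vertex uses up nothing.\<close>
    define m where "m = card (boundary C E1)"
    define p where "p = m - 1"
    let ?V = "V - C"
    have bd: "boundary ?V D = boundary V D" using CV unfolding boundary_def by auto
    have fr: "fresh ?V D = ?U - C" using bd unfolding fresh_def by auto
    have step: "card (boundary ?V E) + p \<le> card (boundary V D) + q"
      if E: "linked E" "D \<subseteq> E" "E \<subseteq> ?V" for E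
    proof (cases "m = 0")
      case True
      have "card (boundary ?V E) \<le> card (boundary V E)"
        using fin by (intro card_mono finite_boundary) (auto simp: boundary_def)
      moreover have "E \<subseteq> V" using E by blast
      ultimately show ?thesis using True grow[of E] E by (simp add: p_def)
    next
      case False
      let ?E = "insert y E \<union> E1"
      have "y \<in> E \<or> y \<in> boundary ?V E" using yB zy E unfolding boundary_def by blast
      then have "linked (insert y E)"
        using E linked_insert_boundary insert_absorb by metis
      then have "linked ?E" using linked_Un[of "insert y E" E1 y z] E1 zy adj_sym by blast
      moreover have "?E \<subseteq> V" using E E1 CV zy by blast
      ultimately have "card (boundary V ?E) \<le> card (boundary V D) + q"
        using grow[of ?E] E by blast
      moreover have "card ((boundary ?V E - {y}) \<union> boundary C E1) \<le> card (boundary V ?E)"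
        using fin E1 E CV zy by (intro card_mono finite_boundary) (auto simp: boundary_def)
      moreover have "card ((boundary ?V E - {y}) \<union> boundary C E1)
                       = card (boundary ?V E - {y}) + m"
        unfolding m_def using fin finC by (intro card_Un_disjoint) (auto simp: boundary_def)
      moreover have "card (boundary ?V E) \<le> card (boundary ?V E - {y}) + 1"
        using diff_card_le_card_Diff[of "{y}" "boundary ?V E"] by simp
      ultimately show ?thesis using False by (simp add: p_def)
    qed
    from step[of D] D CV bd have pq: "p \<le> q" by auto
    then obtain q' where q': "q = p + q'" using le_Suc_ex by blast
    have "darts (fresh ?V D) \<le> 2 * card (fresh ?V D) + q'\<^sup>2 + 4 * q'"
    proof (rule less.hyps[THEN conjunct1])
      show "card (fresh ?V D) < card ?U"
        unfolding fr using C finite_fresh[OF fin] by (intro psubset_card_mono) auto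
      show "\<exists>x\<in>X. \<exists>y\<in>?V - X. adj x y" if X: "X \<subseteq> fresh ?V D" "X \<noteq> {}" for X
      proof -
        obtain x y where xy: "x \<in> X" "y \<in> V - X" "adj x y" using reach[of X] X fr by auto
        then have "y \<notin> C" using sep[of y x] X fr adj_sym by blast
        then show ?thesis using xy by blast
      qed
      show "card (boundary ?V E) \<le> card (boundary ?V D) + q'"
        if "linked E" "D \<subseteq> E" "E \<subseteq> ?V" for E
        using step[OF that] bd q' by simp
      show "darts A + 4 \<le> 2 * card A + k\<^sup>2"
        if "A \<subseteq> fresh ?V D" "linked A" "2 \<le> k" "few_leaves A k" for A k
        using small[of A k] that fr by blast
    qed (use fin D CV in auto)
    then have rest: "darts (?U - C) \<le> 2 * card (?U - C) + q'\<^sup>2 + 4 * q'" using fr by simp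
    have rooted: "card (boundary C E) \<le> m" if "linked E" "z \<in> E" "E \<subseteq> C" for E
      using best that by (auto simp: m_def)
    have "few_leaves C (m + 1)"
      using few_leaves_rooted[OF finC C(3) zy(1) rooted] by blast
    then have "few_leaves C (p + 2)" unfolding few_leaves_def p_def by fastforce
    then have part: "darts C + 4 \<le> 2 * card C + (p + 2)\<^sup>2" using small[of C "p + 2"] C by simp
    have U: "?U = C \<union> (?U - C)" using C by blast
    have "joins C (?U - C) = 0" using sep finite_fresh[OF fin] by (intro joins_eq_0) auto
    then have dU: "darts ?U = darts C + darts (?U - C)"
      using darts_Un[of C "?U - C"] finC finite_fresh[OF fin] U by simp
    have cU: "card ?U = card C + card (?U - C)"
      using card_Un_disjoint[of C "?U - C"] finC finite_fresh[OF fin] U by simp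
    have "darts ?U \<le> 2 * card ?U + q\<^sup>2 + 4 * q"
      using part rest dU cU unfolding q' by (simp add: power2_eq_square algebra_simps)
    moreover have "darts ?U + 2 \<le> 2 * card ?U" if "q = 0"
    proof -
      have "m \<le> 1" "q' = 0" using that q' by (auto simp: p_def)
      then have "darts C + 2 \<le> 2 * card C"
        using path_like[OF finC C(3) zy(1)] rooted by (meson order_trans)
      then show ?thesis using rest dU cU \<open>q' = 0\<close> by simp
    qed
    ultimately show ?thesis by blast
  qed
qed

lemma tree_count_bound:
  fixes d j b :: nat
  assumes "3 \<le> d" "j + d \<le> b + 1" "d \<le> b"
  shows "(j + b) * d + 2 + b \<le> 2 * (j + b) + b\<^sup>2"
proof -
  obtain e where d: "d = e + 3" using assms(1) le_Suc_ex by (metis add.commute)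
  obtain f where b: "b = e + 3 + f" using assms(3) d le_Suc_ex by blast
  have "j \<le> f + 1" using assms b d by simp
  then have "j * (e + 1) \<le> (f + 1) * (e + 1)" by (rule mult_right_mono) simp
  then show ?thesis unfolding d b by (simp add: algebra_simps power2_eq_square)
qed

lemma combine_counts:
  fixes X :: nat
  assumes "e \<le> X + s + eU" "X + 2 + b \<le> 2 * (j + b) + B" "n = j + b + u"
    "eU \<le> 2 * u + Q + 4 * q" "s \<le> b" "B + Q + 4 * q + 2 \<le> M"
  shows "e + 4 \<le> 2 * n + M"
  using assms by simp

text \<open>Compared with \<open>edge_bound\<close>, the square replaces \<open>m * (m - 1)\<close>.
  This makes room for the graphs on \<open>m + 2\<close> vertices; the complement of a perfect
  matching attains equality there. The slack is also what lets the induction go through by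
  counting degrees alone.\<close>

lemma edge_bound_all_orders:
  assumes "finite V" "linked V" "2 \<le> m" "few_leaves V m"
  shows "darts V + 4 \<le> 2 * card V + m\<^sup>2"
  using assms
proof (induction "card V" arbitrary: V m rule: less_induct)
  case less
  note fin = less.prems(1) and V = less.prems(2) and m = less.prems(3) and few = less.prems(4)
  have m4: "4 \<le> m\<^sup>2" using power_mono[of 2 m 2] m by simp
  show ?case
  proof (cases "\<forall>v\<in>V. degree V v \<le> 2")
    case True
    then have "darts V \<le> card V * 2"
      unfolding darts_def using sum_bounded_above[of V "degree V" 2] by simp
    then show ?thesis using m4 by simp
  next
    case False
    then obtain v where v: "v \<in> V" "3 \<le> degree V v" by fastforce
    define d where "d = Max (degree V ` V)"
    have deg: "degree V v \<le> d" if "v \<in> V" for v using that fin by (simp add: d_def)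
    have d3: "3 \<le> d" using v deg by (meson order_trans)
    have "d \<in> degree V ` V" unfolding d_def using fin v by (intro Max_in) auto
    then obtain r where r: "r \<in> V" "degree V r = d" by blast
    obtain D where D: "linked D" "D \<subseteq> V" "card D + d \<le> card (boundary V D) + 1"
      and stall: "\<And>y. y \<in> boundary V D \<Longrightarrow> degree (fresh V D) y \<le> 1"
      using stalled_tree_exists[OF fin r(1)] r(2) by blast
    let ?b = "card (boundary V D)" and ?U = "fresh V D"
    have "D \<noteq> {}" "finite D" using D linked_nonempty fin finite_subset by blast+
    then have j1: "1 \<le> card D" by (simp add: Suc_leI card_gt_0_iff)
    have "?b \<le> m" using few few_leavesD D by blast
    then obtain q where q: "m = ?b + q" using le_Suc_ex by blast
    have "card (D \<union> boundary V D) = card D + ?b"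
      using boundary_fresh_partition(3)[OF D(2)] \<open>finite D\<close> finite_boundary[OF fin]
      by (intro card_Un_disjoint) auto
    moreover have "card V = card (D \<union> boundary V D) + card ?U"
      using boundary_fresh_partition[OF D(2)] \<open>finite D\<close> finite_boundary[OF fin] finite_fresh[OF fin]
      by (metis card_Un_disjoint finite_UnI)
    ultimately have n: "card V = card D + ?b + card ?U" by simp
    have smaller: "card C < card V" if "C \<subseteq> ?U" for C
      using n j1 that card_mono[OF finite_fresh[OF fin] that] by linarith
    have U: "darts ?U \<le> 2 * card ?U + q\<^sup>2 + 4 * q"
      "q = 0 \<and> ?U \<noteq> {} \<longrightarrow> darts ?U + 2 \<le> 2 * card ?U"
    proof -
      have "darts ?U \<le> 2 * card ?U + q\<^sup>2 + 4 * q \<and>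
        (q = 0 \<and> ?U \<noteq> {} \<longrightarrow> darts ?U + 2 \<le> 2 * card ?U)"
      proof (rule darts_fresh_le[OF fin D(2,1)])
        show "\<exists>x\<in>X. \<exists>y\<in>V - X. adj x y" if "X \<subseteq> ?U" "X \<noteq> {}" for X
          using fresh_reached[OF V D(2) \<open>D \<noteq> {}\<close> that] by blast
        show "card (boundary V E) \<le> ?b + q" if "linked E" "D \<subseteq> E" "E \<subseteq> V" for E
          using few few_leavesD that q by blast
        show "darts C + 4 \<le> 2 * card C + k\<^sup>2"
          if "C \<subseteq> ?U" "linked C" "2 \<le> k" "few_leaves C k" for C k
          using less.hyps[of C k] smaller that finite_fresh[OF fin] finite_subset by metis
      qed
      then show "darts ?U \<le> 2 * card ?U + q\<^sup>2 + 4 * q"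
        "q = 0 \<and> ?U \<noteq> {} \<longrightarrow> darts ?U + 2 \<le> 2 * card ?U" by auto
    qed
    have total: "darts V \<le> (card D + ?b) * d + joins (boundary V D) ?U + darts ?U"
      by (rule darts_le_by_tree[OF fin D(2) deg])
    have sigma: "joins (boundary V D) ?U \<le> ?b" by (rule joins_le_card[OF stall])
    have bd: "d \<le> ?b" using D(3) j1 by linarith
    have K: "(card D + ?b) * d + 2 + ?b \<le> 2 * (card D + ?b) + ?b\<^sup>2"
      by (rule tree_count_bound[OF d3 D(3) bd])
    consider "q = 0" "?U = {}" | "q = 0" "?U \<noteq> {}" | "1 \<le> q" by fastforce
    then show ?thesis
    proof cases
      case 1
      then have "joins (boundary V D) ?U = 0" "darts ?U = 0" by (auto simp: joins_def degree_def darts_def)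
      then show ?thesis using total K n q 1 bd d3 by simp
    next
      case 2
      then show ?thesis using total K n q U(2) sigma by simp
    next
      case 3
      have "3 * q \<le> ?b * q" using bd d3 by simp
      then have "4 * q + 2 \<le> 2 * (?b * q)" using 3 by linarith
      then have "?b\<^sup>2 + q\<^sup>2 + 4 * q + 2 \<le> m\<^sup>2" unfolding q by (simp add: power2_eq_square algebra_simps)
      then show ?thesis by (rule combine_counts[OF total K n U(1) sigma])
    qed
  qed
qed

end


section \<open>Contracting an edge\<close>

definition contract :: "('a \<Rightarrow> 'a \<Rightarrow> bool) \<Rightarrow> 'a \<Rightarrow> 'a \<Rightarrow> 'a \<Rightarrow> 'a \<Rightarrow> bool" where
  "contract adj u v x y \<longleftrightarrow> x \<noteq> y \<and> (adj x y \<or> x = u \<and> adj v y \<or> y = u \<and> adj x v)"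

context adjacency
begin

lemma adjacency_contract: "adjacency (contract adj u v)"
proof
  show "contract adj u v y x" if "contract adj u v x y" for x y
    using that adj_sym[of x y] adj_sym[of v y] adj_sym[of x v] unfolding contract_def by argo
qed (simp add: contract_def)

lemma linked_contract:
  assumes V: "linked V" and uv: "u \<in> V" "v \<in> V" "adj u v"
  shows "adjacency.linked (contract adj u v) (V - {v})"
proof -
  interpret c: adjacency "contract adj u v" by (rule adjacency_contract)
  have neq: "u \<noteq> v" using uv adj_irrefl by blast
  show ?thesis
  proof (rule c.linkedI)
    show "V - {v} \<noteq> {}" using uv neq by blast
  next
    fix X assume X: "X \<subseteq> V - {v}" "X \<noteq> {}" "X \<noteq> V - {v}"
    show "\<exists>x\<in>X. \<exists>y\<in>V - {v} - X. contract adj u v x y"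
    proof (cases "u \<in> X")
      case True
      have "insert v X \<subseteq> V" "insert v X \<noteq> V" using X uv by auto
      then obtain x y where xy: "x \<in> insert v X" "y \<in> V" "y \<notin> insert v X" "adj x y"
        using linked_cut[OF V, of "insert v X"] by blast
      show ?thesis
      proof (cases "x = v")
        case True
        then have "contract adj u v u y" using xy \<open>u \<in> X\<close> by (auto simp: contract_def)
        then show ?thesis using xy \<open>u \<in> X\<close> by blast
      next
        case False
        then have "contract adj u v x y" using xy by (auto simp: contract_def)
        then show ?thesis using xy False by blast
      qed
    next
      case False
      have "X \<subseteq> V" "X \<noteq> V" using X uv by auto
      then obtain x y where xy: "x \<in> X" "y \<in> V" "y \<notin> X" "adj x y"
        using linked_cut[OF V, of X] X by blast
      show ?thesis
      proof (cases "y = v")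
        case True
        then have "contract adj u v x u" using xy False by (auto simp: contract_def)
        then show ?thesis using xy uv neq False by blast
      next
        case False
        then have "contract adj u v x y" using xy by (auto simp: contract_def)
        then show ?thesis using xy False by blast
      qed
    qed
  qed
qed

text \<open>A connected set of the contracted graph becomes connected in the original one when the merged
  vertex \<open>u\<close>, if present, is split into \<open>u\<close> and \<open>v\<close>
  again.\<close>

lemma linked_uncontract:
  assumes D: "adjacency.linked (contract adj u v) D" and uv: "adj u v" "v \<notin> D"
  shows "u \<in> D \<Longrightarrow> linked (insert v D)" and "u \<notin> D \<Longrightarrow> linked D"
proof -
  interpret c: adjacency "contract adj u v" by (rule adjacency_contract)
  show "linked (insert v D)" if u: "u \<in> D"
  proof (rule linkedI)
    fix X assume X: "X \<subseteq> insert v D" "X \<noteq> {}" "X \<noteq> insert v D"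
    show "\<exists>x\<in>X. \<exists>y\<in>insert v D - X. adj x y"
    proof (cases "u \<in> X \<longleftrightarrow> v \<in> X")
      case False
      then show ?thesis using uv u adj_sym[of u v] by blast
    next
      case True
      have "X \<inter> D \<subseteq> D" "X \<inter> D \<noteq> {}" "X \<inter> D \<noteq> D" using X True u uv by blast+
      then obtain x y where "x \<in> X \<inter> D" "y \<in> D" "y \<notin> X \<inter> D" "contract adj u v x y"
        using c.linked_cut[OF D] by metis
      then show ?thesis using True uv unfolding contract_def by blast
    qed
  qed simp
  show "linked D" if u: "u \<notin> D"
  proof (rule linkedI)
    show "D \<noteq> {}" using D c.linked_nonempty by blast
  next
    fix X assume X: "X \<subseteq> D" "X \<noteq> {}" "X \<noteq> D"
    obtain x y where "x \<in> X" "y \<in> D" "y \<notin> X" "contract adj u v x y"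
      using c.linked_cut[OF D X] by metis
    then show "\<exists>x\<in>X. \<exists>y\<in>D - X. adj x y" using u X unfolding contract_def by blast
  qed
qed

text \<open>Undoing the contraction inside a connected set does not change its boundary. If the merged
  vertex lies on the boundary instead, one of its two halves lies on the boundary in the
  original graph.\<close>

lemma few_leaves_contract:
  assumes fin: "finite V" and few: "few_leaves V t" and uv: "u \<in> V" "v \<in> V" "adj u v"
  shows "adjacency.few_leaves (contract adj u v) (V - {v}) t"
proof -
  interpret c: adjacency "contract adj u v" by (rule adjacency_contract)
  have neq: "u \<noteq> v" using uv adj_irrefl by blast
  show ?thesis
    unfolding c.few_leaves_def
  proof (intro allI impI)
    fix D assume D: "c.linked D \<and> D \<subseteq> V - {v}"
    then have vD: "v \<notin> D" by blast
    show "card (c.boundary (V - {v}) D) \<le> t"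
    proof (cases "u \<in> D")
      case True
      have "c.boundary (V - {v}) D \<subseteq> boundary V (insert v D)"
        unfolding c.boundary_def boundary_def contract_def using True D by auto
      then have "card (c.boundary (V - {v}) D) \<le> card (boundary V (insert v D))"
        using fin finite_boundary by (intro card_mono)
      also have "\<dots> \<le> t"
        using few_leavesD[OF few, of "insert v D"] linked_uncontract(1)[of u v D] D uv True by blast
      finally show ?thesis .
    next
      case False
      then have "linked D" using linked_uncontract(2)[of u v D] D uv by blast
      then have t: "card (boundary V D) \<le> t" using few few_leavesD D by blast
      \<comment> \<open>The half of the merged vertex that is adjacent to \<open>D\<close>.\<close>
      let ?f = "\<lambda>x. if x = u \<and> u \<notin> boundary V D then v else x"
      have "?f ` c.boundary (V - {v}) D \<subseteq> boundary V D"
        unfolding c.boundary_def boundary_def contract_def using False D uv by auto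
      moreover have "inj_on ?f (c.boundary (V - {v}) D)"
        by (rule inj_onI) (auto simp: c.boundary_def split: if_splits)
      ultimately have "card (c.boundary (V - {v}) D) \<le> card (boundary V D)"
        using card_inj_on_le finite_boundary[OF fin] by blast
      then show ?thesis using t by simp
    qed
  qed
qed

text \<open>The contraction identifies two further edges exactly when \<open>u\<close> and \<open>v\<close>
  have a common neighbour; otherwise it loses only the edge itself.\<close>

lemma darts_contract:
  assumes fin: "finite V" and uv: "u \<in> V" "v \<in> V" "adj u v"
    and no: "\<And>w. w \<in> V \<Longrightarrow> adj u w \<Longrightarrow> \<not> adj v w"
  shows "adjacency.darts (contract adj u v) (V - {v}) + 2 = darts V"
proof -
  interpret c: adjacency "contract adj u v" by (rule adjacency_contract)
  have neq: "u \<noteq> v" using uv adj_irrefl by blast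
  define W where "W = V - {u, v}"
  have W: "finite W" "u \<notin> W" "v \<notin> insert u W" "V = insert v (insert u W)" "V - {v} = insert u W"
    using fin uv neq unfolding W_def by auto
  have "{y \<in> W. contract adj u v x y} = {y \<in> W. adj x y}" if "x \<in> W" for x
    using that W(2) adj_irrefl unfolding contract_def by auto
  then have "c.degree W x = degree W x" if "x \<in> W" for x
    using that by (simp add: c.degree_def degree_def)
  then have "c.darts W = darts W" by (simp add: c.darts_def darts_def)
  moreover have "c.degree W u = degree W u + degree W v"
  proof -
    have "{y \<in> W. contract adj u v u y} = {y \<in> W. adj u y} \<union> {y \<in> W. adj v y}"
      using W(2) unfolding contract_def by auto
    moreover have "{y \<in> W. adj u y} \<inter> {y \<in> W. adj v y} = {}" using no W by blast
    ultimately show ?thesis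
      unfolding c.degree_def degree_def using W(1) by (simp add: card_Un_disjoint)
  qed
  moreover have "degree (insert u W) v = degree W v + 1"
  proof -
    have "{y \<in> insert u W. adj v y} = insert u {y \<in> W. adj v y}" using uv adj_sym by blast
    then show ?thesis unfolding degree_def using W(1,2) by simp
  qed
  moreover have "c.darts (V - {v}) = c.darts W + 2 * c.degree W u"
    unfolding W(5) using c.darts_insert W by blast
  moreover have "darts V = darts W + 2 * degree W u + 2 * degree (insert u W) v"
    unfolding W(4) using darts_insert[of "insert u W" v] darts_insert[of W u] W by simp
  ultimately show ?thesis by simp
qed

section \<open>Growth that cannot gain any more\<close>

text \<open>The counts for a stalled set whose boundary \<open>b\<close> is \<open>q\<close> below the
  maximum. The difference between the two sides grows with the product of \<open>b\<close> and
  \<open>q\<close>; it vanishes at \<open>b = 3\<close>, \<open>q = 1\<close>, where parity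
  decides.\<close>

lemma combine_counts_strict:
  fixes b q :: nat
  assumes e: "e \<le> X + s + eU" and X: "X + 2 + b \<le> 2 * (j + b) + b\<^sup>2" and n: "n = j + b + u"
    and eU: "eU \<le> 2 * u + q\<^sup>2 + 4 * q" "even eU" and s: "s \<le> b" and b: "3 \<le> b" and q: "1 \<le> q"
  shows "e < 2 * n + (b + q) * (b + q - 1)"
proof -
  obtain c where c: "b = 3 + c" using b le_Suc_ex by blast
  obtain k where k: "q = 1 + k" using q le_Suc_ex by blast
  have main: "e + 2 \<le> 2 * (j + b) + b\<^sup>2 + eU" using e X s by simp
  have R: "(b + q) * (b + q - 1) = (4 + c + k) * (3 + c + k)" unfolding c k by (simp add: add.assoc)
  show ?thesis
  proof (cases "c = 0 \<and> k = 0")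
    case True
    then have bq: "b = 3" "q = 1" using c k by simp_all
    have "eU \<le> 2 * u + 5" using eU(1) bq by simp
    moreover have "eU \<noteq> 2 * u + 5" using eU(2) by presburger
    ultimately have "eU \<le> 2 * u + 4" by simp
    then show ?thesis using main n unfolding bq by simp
  next
    case False
    then have ck: "1 \<le> c + k" by (cases c) auto
    have "b\<^sup>2 + q\<^sup>2 + 4 * q + (2 * c * k + c + k) = (4 + c + k) * (3 + c + k) + 2"
      unfolding c k by (simp add: power2_eq_square algebra_simps)
    then have "b\<^sup>2 + q\<^sup>2 + 4 * q < (4 + c + k) * (3 + c + k) + 2"
      using ck by linarith
    then show ?thesis using main n eU(1) R by simp
  qed
qed

text \<open>With a maximal boundary every further growth step is one for one. If the unreached part
  contained an edge, there would be one at a vertex \<open>z\<close> adjacent to the boundary. A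
  common neighbour of its ends would either be a boundary vertex with two unreached neighbours,
  or give \<open>z\<close> two of them; both would enlarge the boundary. So this edge would lie
  in no triangle.\<close>

lemma fresh_edgeless:
  assumes fin: "finite V" and V: "linked V" and few: "few_leaves V t"
    and D: "linked D" "D \<subseteq> V" "card (boundary V D) = t"
    and tri: "\<And>u v. u \<in> V \<Longrightarrow> v \<in> V \<Longrightarrow> adj u v \<Longrightarrow> \<exists>w\<in>V. adj u w \<and> adj v w"
  shows "darts (fresh V D) = 0"
proof (rule ccontr)
  let ?U = "fresh V D" and ?B = "boundary V D"
  assume "darts ?U \<noteq> 0"
  then obtain a where a: "a \<in> ?U" "degree ?U a \<noteq> 0"
    unfolding darts_def by (metis sum.neutral)
  then obtain a' where a': "a' \<in> ?U" "adj a a'" unfolding degree_def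
    by (metis (mono_tags, lifting) card.empty empty_Collect_eq)
  have DV: "D \<noteq> {}" using D linked_nonempty by blast
  obtain y z z' where z: "y \<in> ?B" "z \<in> ?U" "adj y z" "z' \<in> ?U" "adj z z'"
  proof (cases "\<exists>y\<in>?B. adj y a")
    case True
    then show ?thesis using that a a' by blast
  next
    case False
    let ?X = "{x \<in> ?U. \<forall>y\<in>?B. \<not> adj y x}"
    have X: "?X \<subseteq> ?U" "?X \<noteq> {}" using False a by auto
    obtain x w where xw: "x \<in> ?X" "w \<in> V - ?X" "w \<notin> D" "adj x w"
      using fresh_reached[OF V D(2) DV X] by blast
    then have "w \<notin> ?B" using adj_sym by blast
    then have w: "w \<in> ?U" using xw unfolding fresh_def by blast
    then obtain y where "y \<in> ?B" "adj y w" using xw by blast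
    then show ?thesis using that w xw adj_sym by blast
  qed
  have B1: "degree ?U w \<le> 1" if "w \<in> ?B" for w
  proof -
    have "insert w D \<subseteq> V" using that D unfolding boundary_def by blast
    then have "card (boundary V (insert w D)) \<le> t"
      using few few_leavesD linked_insert_boundary[OF D(1) that] by blast
    then show ?thesis using card_boundary_insert[OF fin that] D(3) by simp
  qed
  let ?E = "insert y D"
  have bdE: "boundary V ?E = (?B - {y}) \<union> {x \<in> ?U. adj y x}" by (rule boundary_insert[OF z(1)])
  have one: "{x \<in> ?U. adj y x} = {z}"
  proof -
    have "card {x \<in> ?U. adj y x} \<le> 1" using B1[OF z(1)] by (simp add: degree_def)
    then show ?thesis using z card_le_Suc0_iff_eq[of "{x \<in> ?U. adj y x}"] finite_fresh[OF fin] by auto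
  qed
  have zE: "z \<in> boundary V ?E" using bdE one by blast
  have "y \<in> V" using z(1) unfolding boundary_def by blast
  then have E: "linked ?E" "?E \<subseteq> V" using linked_insert_boundary[OF D(1) z(1)] D by blast+
  have cE: "card (boundary V ?E) + 1 = t + 1"
    using card_boundary_insert[OF fin z(1)] D(3) one by (simp add: degree_def)
  have "insert z ?E \<subseteq> V" using E z unfolding fresh_def by blast
  then have "card (boundary V (insert z ?E)) \<le> t"
    using few few_leavesD linked_insert_boundary[OF E(1) zE] by blast
  then have "degree (fresh V ?E) z \<le> 1" using card_boundary_insert[OF fin zE] cE by simp
  moreover have "fresh V ?E = ?U - {z}"
    using bdE one z unfolding fresh_def boundary_def by auto
  ultimately have z1: "card {x \<in> ?U - {z}. adj z x} \<le> 1" by (simp add: degree_def)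
  have zV: "z \<in> V" "z' \<in> V" using z unfolding fresh_def by auto
  obtain w where w: "w \<in> V" "adj z w" "adj z' w" using tri[OF zV z(5)] by blast
  have "w \<notin> D" using w z(2) fresh_not_adj[of w D z V] adj_sym by blast
  have neq: "z \<noteq> z'" "z' \<noteq> w" "z \<noteq> w" using z w adj_irrefl by blast+
  show False
  proof (cases "w \<in> ?B")
    case True
    have "card {z, z'} \<le> degree ?U w"
      unfolding degree_def using z w adj_sym finite_fresh[OF fin] by (intro card_mono) auto
    then show False using B1[OF True] neq by simp
  next
    case False
    then have "w \<in> ?U" using w \<open>w \<notin> D\<close> unfolding fresh_def by blast
    then have "card {z', w} \<le> card {x \<in> ?U - {z}. adj z x}"
      using z w neq finite_fresh[OF fin] by (intro card_mono) auto
    then show False using z1 neq by simp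
  qed
qed

end


context adjacency
begin

section \<open>Non-adjacent pairs\<close>

definition co :: "'a \<Rightarrow> 'a \<Rightarrow> bool" where
  "co x y \<longleftrightarrow> x \<noteq> y \<and> \<not> adj x y"

lemma adjacency_co: "adjacency co"
  by standard (auto simp: co_def dest: adj_sym)

end

text \<open>The complement is again an adjacency relation. A locale of its own is needed for this instance, because
  making \<open>adjacency\<close> a sublocale of itself would produce complements of complements without end.\<close>

locale complemented = adjacency

sublocale complemented \<subseteq> co: adjacency co
  by (rule adjacency_co)

context complemented
begin

lemma co_sym: "co x y \<Longrightarrow> co y x"
  using co.adj_sym .

lemma degree_co:
  assumes "finite V" "v \<in> V"
  shows "degree V v + co.degree V v + 1 = card V"
proof -
  have "V - {v} = {u \<in> V. adj v u} \<union> {u \<in> V. co v u}"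
    using adj_irrefl unfolding co_def by auto
  then have "card (V - {v}) = degree V v + co.degree V v"
    unfolding degree_def co.degree_def using assms
    by (subst card_Un_disjoint[symmetric]) (auto simp: co_def)
  then show ?thesis using assms by (metis Suc_eq_plus1 card_Suc_Diff1)
qed

lemma darts_co:
  assumes "finite V"
  shows "darts V + co.darts V = card V * (card V - 1)"
proof -
  have "degree V v + co.degree V v = card V - 1" if "v \<in> V" for v
    using degree_co[OF assms that] by simp
  then show ?thesis
    unfolding darts_def co.darts_def by (simp add: sum.distrib[symmetric])
qed

lemma fresh_degree_le_1:
  assumes fin: "finite V" and few: "few_leaves V t"
    and D: "linked D" "D \<subseteq> V" "card (boundary V D) = t" and y: "y \<in> boundary V D"
  shows "degree (fresh V D) y \<le> 1"
proof -
  have "insert y D \<subseteq> V" using y D unfolding boundary_def by blast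
  then have "card (boundary V (insert y D)) \<le> t"
    using few few_leavesD linked_insert_boundary[OF D(1) y] by blast
  then show ?thesis using card_boundary_insert[OF fin y] D(3) by simp
qed

lemma unique_fresh_neighbour:
  assumes fin: "finite V" and "degree (fresh V D) y \<le> 1"
    and "z \<in> fresh V D" "adj y z" "z' \<in> fresh V D" "adj y z'"
  shows "z = z'"
  using assms finite_fresh[OF fin] card_le_Suc0_iff_eq[of "{u \<in> fresh V D. adj y u}"]
  by (simp add: degree_def)

lemma joins_eq_card:
  assumes B: "finite B" and U: "finite U" and le: "\<And>y. y \<in> B \<Longrightarrow> degree U y \<le> 1"
  shows "joins B U = card {y \<in> B. \<exists>z\<in>U. adj y z}"
proof -
  have "degree U y = of_bool (\<exists>z\<in>U. adj y z)" if "y \<in> B" for y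
  proof (cases "\<exists>z\<in>U. adj y z")
    case True
    then have "degree U y \<noteq> 0" unfolding degree_def using U by auto
    then show ?thesis using le[OF that] True by simp
  next
    case False
    then have "{u \<in> U. adj y u} = {}" by blast
    then have "degree U y = 0" unfolding degree_def by (simp only: card.empty)
    then show ?thesis using False by simp
  qed
  then show ?thesis unfolding joins_def using B by (simp add: Int_def)
qed

section \<open>A vertex that reaches the maximal boundary at once\<close>

text \<open>Let \<open>S\<close> be the set of neighbours of \<open>r\<close> that have a (necessarily
  unique) neighbour in the unreached part. Each of them costs an additional edge, and the
  missing edges among the neighbours of \<open>r\<close> have to compensate for this.

  If \<open>x\<close> and \<open>y\<close> in \<open>S\<close> are adjacent and see different
  unreached vertices, then \<open>{x, y}\<close> has \<open>r\<close> and both these vertices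
  on its boundary, so it must miss another neighbour of \<open>r\<close>. Hence \<open>x\<close>
  and \<open>y\<close> have distance at most two in the complement, and \<open>S\<close> lies in
  one component of it. If all of \<open>S\<close> sees the same vertex \<open>z\<close>, the
  graph has one more vertex beyond \<open>z\<close>, and \<open>{x, z}\<close> must miss a
  neighbour of \<open>r\<close> outside \<open>S\<close>.\<close>

lemma hub_bound:
  assumes fin: "finite V" and V: "linked V" and few: "few_leaves V t"
    and r: "r \<in> V" "degree V r = t" and n: "t + 3 \<le> card V"
    and U: "darts (fresh V {r}) = 0 \<or> card (fresh V {r}) = 2"
  shows "darts V < 2 * card V + t * (t - 1)"
proof -
  let ?B = "boundary V {r}" and ?U = "fresh V {r}"
  let ?S = "{y \<in> ?B. \<exists>z\<in>?U. adj y z}"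
  have finBU: "finite ?B" "finite ?U" using fin finite_boundary finite_fresh by auto
  have cB: "card ?B = t" using r by (simp add: card_boundary_singleton)
  have rr: "{r} \<subseteq> V" "{r} \<noteq> {}" "linked {r}" using r linked_singleton by auto
  have part: "V = insert r (?B \<union> ?U)" "r \<notin> ?B" "r \<notin> ?U" "?B \<inter> ?U = {}"
    using r unfolding fresh_def boundary_def by auto
  have cBU: "card (?B \<union> ?U) = t + card ?U"
    using card_Un_disjoint[OF finBU part(4)] cB by simp
  have "card V = card (insert r (?B \<union> ?U))" using part(1) by simp
  then have cV: "card V = 1 + t + card ?U"
    using cBU finBU part(2,3) by (simp add: card_insert_if)
  then have U2: "2 \<le> card ?U" using n by simp
  have st: "degree ?U y \<le> 1" if "y \<in> ?B" for y
    using fresh_degree_le_1[OF fin few rr(3,1) cB that] .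
  have uniq: "z = z'" if "y \<in> ?B" "z \<in> ?U" "z' \<in> ?U" "adj y z" "adj y z'" for y z z'
    using unique_fresh_neighbour[OF fin st[OF that(1)]] that by blast
  have sigma: "joins ?B ?U = card ?S" by (rule joins_eq_card[OF finBU st])
  have adj_r: "adj r w" if "w \<in> ?B" for w using that unfolding boundary_def by blast
  have few': "card X \<le> t" if "linked D" "D \<subseteq> V" "X \<subseteq> boundary V D" for X D
    using card_mono[OF finite_boundary[OF fin] that(3)] few_leavesD[OF few that(1,2)] by linarith
  have missing: "2 * card ?S \<le> co.darts ?B + 2"
  proof (cases "\<exists>x\<in>?S. \<exists>x'\<in>?S. \<exists>z\<in>?U. \<exists>z'\<in>?U. adj x z \<and> adj x' z' \<and> z \<noteq> z'")
    case True
    then obtain x0 x1 z0 z1 where x01: "x0 \<in> ?S" "x1 \<in> ?S" "z0 \<in> ?U" "z1 \<in> ?U"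
      "adj x0 z0" "adj x1 z1" "z0 \<noteq> z1" by blast
    have "x0 \<in> ?B" using x01 by blast
    then obtain C where C: "x0 \<in> C" "C \<subseteq> ?B" "co.linked C"
      and sep: "\<And>x y. x \<in> C \<Longrightarrow> y \<in> ?B - C \<Longrightarrow> \<not> co x y"
      using co.component_exists[OF finBU(1)] by blast
    have near: "y \<in> C" if x: "x \<in> C" "x \<in> ?B" "z \<in> ?U" "adj x z"
      and y: "y \<in> ?B" "z' \<in> ?U" "adj y z'" and zz: "z \<noteq> z'" for x y z z'
    proof (rule ccontr)
      assume yC: "y \<notin> C"
      have xy: "x \<noteq> y" using uniq x y zz by blast
      then have a: "adj x y" using sep[OF x(1)] y yC unfolding co_def by blast
      let ?X = "insert r (insert z (insert z' (?B - {x, y})))"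
      have "?X \<subseteq> boundary V {x, y}"
      proof
        fix w assume w: "w \<in> ?X"
        have wV: "w \<in> V" using w part(1) x y by blast
        have w': "w \<noteq> x" "w \<noteq> y" using w x y part by auto
        have "adj x w \<or> adj y w"
        proof (cases "w \<in> ?B - {x, y}")
          case True
          have "\<not> co x w \<or> \<not> co w y"
            using sep[of x w] sep[of w y] x y yC True by blast
          then show ?thesis using w' adj_sym unfolding co_def by blast
        next
          case False
          then show ?thesis using w adj_r[OF x(2)] adj_sym x y by blast
        qed
        then show "w \<in> boundary V {x, y}" using wV w' unfolding boundary_def by blast
      qed
      moreover have "linked {x, y}" "{x, y} \<subseteq> V" using a linked_pair x y part by auto
      ultimately have "card ?X \<le> t" using few' by blast
      moreover have "card ?X = 3 + card (?B - {x, y})"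
        using finBU part x y zz by (auto simp: card_insert_if)
      moreover have "card (?B - {x, y}) + 2 = t"
        using card_Diff_subset[of "{x, y}" ?B] card_mono[of ?B "{x, y}"] x y xy cB finBU by simp
      ultimately show False by simp
    qed
    have x1C: "x1 \<in> C" using near[of x0 z0 x1 z1] x01 C by blast
    have "?S \<subseteq> C"
    proof
      fix y assume "y \<in> ?S"
      then obtain z where z: "y \<in> ?B" "z \<in> ?U" "adj y z" by blast
      show "y \<in> C"
      proof (cases "z = z0")
        case True
        then show ?thesis using near[of x1 z1 y z] x01 x1C z by blast
      next
        case False
        then show ?thesis using near[of x0 z0 y z] x01 C z by blast
      qed
    qed
    moreover have "finite C" using C finBU finite_subset by blast
    ultimately have "card ?S \<le> card C" by (intro card_mono)
    moreover have "2 * card C \<le> co.darts C + 2"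
      using co.darts_linked_ge[OF \<open>finite C\<close> C(3)] .
    moreover have "co.darts C \<le> co.darts ?B" using co.darts_mono[OF finBU(1) C(2)] .
    ultimately show ?thesis by linarith
  next
    case False
    have "?U \<noteq> {}" using U2 by auto
    then obtain y0 z where z: "y0 \<in> ?B" "z \<in> ?U" "adj y0 z"
      using fresh_neighbour[OF V rr(1,2)] by blast
    have only: "z' = z" if "y \<in> ?B" "z' \<in> ?U" "adj y z'" for y z'
      using False that z by blast
    have "?U \<noteq> {z}" using U2 by auto
    then obtain z2 where z2: "z2 \<in> ?U" "z2 \<noteq> z" using z by blast
    have ex: "\<exists>w\<in>?U. adj z2 w"
    proof -
      obtain w where w: "w \<in> V - {z2}" "w \<noteq> r" "adj z2 w"
        using fresh_reached[OF V rr(1,2), of "{z2}"] z2 by blast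
      have "w \<notin> ?B" using only[of w z2] z2 w adj_sym by blast
      then show ?thesis using w part(1) by blast
    qed
    then obtain w where w: "w \<in> ?U" "adj z2 w" by blast
    have "degree ?U z2 \<noteq> 0" unfolding degree_def using w finBU by auto
    then have "darts ?U \<noteq> 0" unfolding darts_def using z2 finBU by auto
    then have cU: "card ?U = 2" using U by simp
    have "{z, z2} = ?U" using cU z2 z finBU by (intro card_seteq) auto
    then have "w \<in> {z, z2}" using w by simp
    then have zz2: "adj z2 z" using w adj_irrefl by blast
    have away: "\<exists>w\<in>?B - ?S. co x w" if x: "x \<in> ?S" for x
    proof (rule ccontr)
      assume no: "\<not> ?thesis"
      have xB: "x \<in> ?B" "adj x z" using x only by blast+
      let ?X = "insert r (insert z2 (?B - {x}))"
      have "?X \<subseteq> boundary V {x, z}"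
      proof
        fix w assume w: "w \<in> ?X"
        have w': "w \<in> V" "w \<noteq> x" "w \<noteq> z" using w part xB z z2 by auto
        have "adj x w \<or> adj z w"
        proof (cases "w \<in> ?B - {x}")
          case True
          show ?thesis
          proof (cases "w \<in> ?S")
            case True
            then show ?thesis using only adj_sym by blast
          next
            case False
            then have "w \<in> ?B - ?S" "x \<noteq> w" using True by (simp, blast)
            then show ?thesis using no unfolding co_def by metis
          qed
        next
          case False
          then show ?thesis using w adj_r[OF xB(1)] adj_sym zz2 by blast
        qed
        then show "w \<in> boundary V {x, z}" using w' unfolding boundary_def by blast
      qed
      moreover have "linked {x, z}" "{x, z} \<subseteq> V" using xB linked_pair z part by auto
      ultimately have "card ?X \<le> t" using few' by blast
      moreover have "card ?X = 2 + card (?B - {x})"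
        using finBU part z2 by (auto simp: card_insert_if)
      moreover have "card (?B - {x}) + 1 = t"
        using xB cB finBU by (metis Suc_eq_plus1 card_Suc_Diff1)
      ultimately show False by simp
    qed
    have "1 \<le> co.degree (?B - ?S) x" if x: "x \<in> ?S" for x
    proof -
      obtain w where "w \<in> ?B - ?S" "co x w" using away[OF x] by blast
      then have "card {w} \<le> co.degree (?B - ?S) x"
        unfolding co.degree_def using finBU by (intro card_mono) auto
      then show ?thesis by simp
    qed
    then have "card ?S \<le> co.joins ?S (?B - ?S)"
      unfolding co.joins_def using sum_mono[of ?S "\<lambda>_. 1" "co.degree (?B - ?S)"] by simp
    moreover have "co.darts ?B = co.darts ?S + co.darts (?B - ?S) + 2 * co.joins ?S (?B - ?S)"
    proof -
      have "co.darts (?S \<union> (?B - ?S)) = co.darts ?S + co.darts (?B - ?S) + 2 * co.joins ?S (?B - ?S)"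
        using finBU by (intro co.darts_Un) auto
      moreover have "?S \<union> (?B - ?S) = ?B" by blast
      ultimately show ?thesis by simp
    qed
    ultimately show ?thesis by linarith
  qed
  have "degree V r = degree (?B \<union> ?U) r"
  proof -
    have "{u \<in> V. adj r u} = {u \<in> ?B \<union> ?U. adj r u}"
    proof (rule Collect_cong)
      have "u \<in> V \<longleftrightarrow> u = r \<or> u \<in> ?B \<union> ?U" for u using part(1) by blast
      then show "u \<in> V \<and> adj r u \<longleftrightarrow> u \<in> ?B \<union> ?U \<and> adj r u" for u
        using adj_irrefl by metis
    qed
    then show ?thesis by (simp add: degree_def)
  qed
  moreover have "darts V = darts (?B \<union> ?U) + 2 * degree (?B \<union> ?U) r"
  proof -
    have "darts (insert r (?B \<union> ?U)) = darts (?B \<union> ?U) + 2 * degree (?B \<union> ?U) r"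
      using darts_insert part(2,3) finBU by blast
    then show ?thesis by (simp only: part(1)[symmetric])
  qed
  moreover have "darts (?B \<union> ?U) = darts ?B + darts ?U + 2 * card ?S"
    using darts_Un[OF finBU part(4)] sigma by simp
  ultimately have dV: "darts V = darts ?B + darts ?U + 2 * card ?S + 2 * t" using r by simp
  have dB: "darts ?B + co.darts ?B = t * (t - 1)" using darts_co[OF finBU(1)] cB by simp
  have "darts ?U < 2 * card ?U"
  proof (cases "darts ?U = 0")
    case True
    then show ?thesis using U2 by simp
  next
    case False
    then have "card ?U = 2" using U by simp
    moreover have "darts ?U \<le> card ?U * (card ?U - 1)" using darts_co[OF finBU(2)] by linarith
    ultimately show ?thesis by simp
  qed
  then show ?thesis using dV dB missing cV by linarith
qed

end


section \<open>Maximal degree below the maximal boundary\<close>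

text \<open>The final contradiction of \<open>spread_bound\<close>. The variables stand for the quantities
  that are inserted there; the counting inequality grows linearly in \<open>p * t\<close>,
  while \<open>t\<close> is at least quadratic in \<open>p\<close>.\<close>

lemma spread_arithmetic:
  fixes p t u M a F R \<sigma> :: nat
  assumes p: "1 \<le> p" and count: "p * t + (2 * p + 1) + R \<le> 2 * p * (2 * p + 1) + F + a + p * (p + 1)"
    and F: "F + 2 * u + (p + 1) * (p + 2) \<le> \<sigma>" and st: "\<sigma> \<le> t" and a: "a \<le> 2 * p + 1"
    and R: "\<sigma> \<le> R + M" and M: "M \<le> \<sigma>" and u: "1 \<le> u" and u1: "u = 1 \<Longrightarrow> M + p \<le> t"
  shows False
proof -
  have key: "p * t + 2 + 2 * u \<le> 4 * (p * p) + M"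
    using count F a R by (simp add: algebra_simps)
  show False
  proof (cases "p = 1")
    case True
    then have "t + 2 * u \<le> 2 + M" using key by simp
    then show False using M st u u1 True by (cases "u = 1") auto
  next
    case False
    then obtain k where k: "p = k + 2" using p by (metis add.commute le_Suc_ex less_one linorder_neqE_nat nat_1_add_1 Suc_leI plus_1_eq_Suc not_le)
    have "(k + 3) * (k + 4) + 2 \<le> t" using F st u unfolding k by (simp add: algebra_simps)
    then have "(k + 1) * ((k + 3) * (k + 4) + 2) \<le> (k + 1) * t" by (rule mult_le_mono2)
    moreover have "(k + 1) * t + 4 \<le> 4 * ((k + 2) * (k + 2))"
      using key M st u unfolding k by (simp add: algebra_simps)
    ultimately have "(k + 1) * ((k + 3) * (k + 4) + 2) + 4 \<le> 4 * ((k + 2) * (k + 2))" by linarith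
    then show False by (simp add: algebra_simps)
  qed
qed

lemma small_tree_arithmetic:
  fixes j t :: nat
  assumes big: "2 * (j + t + u) + t * (t - 1) \<le> (j + t) * d + s"
    and s: "s \<le> t" and j: "j \<le> p" and p1: "1 \<le> p" and t: "t = d + p" and d: "d = e + 3"
  shows False
proof -
  obtain i where p: "p = j + i" using j le_Suc_ex by blast
  have t': "t = e + 3 + j + i" "t - 1 = e + 2 + j + i" using t d p by simp_all
  have "2 * (j + t + u) + t * (t - 1) \<le> (j + t) * d + t" using big s by linarith
  then have "j = 0 \<and> i = 0" unfolding t' d by (simp add: algebra_simps)
  then show False using p p1 by simp
qed

context complemented
begin

text \<open>Here \<open>p \<ge> 1\<close> growth steps were needed to get from the degree \<open>d\<close>
  to the boundary \<open>t\<close>. Degree counting alone nearly proves the bound: a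
  counterexample needs exactly \<open>p + 1\<close> vertices in \<open>D\<close>, and the
  total deficit of the degrees in \<open>K\<close>, the union of \<open>D\<close> and its
  boundary, is smaller than the number of boundary vertices with an unreached neighbour. So some
  such vertex \<open>x\<close> has full degree \<open>d\<close>, and only
  \<open>2 * p + 1\<close> non-neighbours in \<open>K\<close>. Every neighbour
  \<open>y\<close> of \<open>x\<close> shares at least \<open>p\<close> of these non-neighbours,
  because the boundary of \<open>{x, y}\<close> has at most \<open>t\<close> vertices. Hence
  the non-neighbours of \<open>x\<close> miss so many vertices themselves that their degree
  deficit exceeds the total.\<close>

lemma spread_bound:
  assumes fin: "finite V" and few: "few_leaves V t"
    and D: "linked D" "D \<subseteq> V" "card (boundary V D) = t"
    and deg: "\<And>v. v \<in> V \<Longrightarrow> degree V v \<le> d" and d: "3 \<le> d"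
    and p: "t = d + p" "1 \<le> p" and small: "card D \<le> p + 1"
    and U0: "darts (fresh V D) = 0"
  shows "darts V < 2 * card V + t * (t - 1)"
proof (rule ccontr)
  assume "\<not> ?thesis"
  then have big: "2 * card V + t * (t - 1) \<le> darts V" by simp
  let ?B = "boundary V D" and ?U = "fresh V D"
  let ?K = "D \<union> ?B"
  define S where "S = {y \<in> ?B. \<exists>z\<in>?U. adj y z}"
  define u where "u = card ?U"
  note part = boundary_fresh_partition[OF D(2)]
  have fins: "finite D" "finite ?B" "finite ?U" "finite ?K" "finite S"
    using fin D(2) finite_boundary finite_fresh finite_subset unfolding S_def by auto
  have cK: "card ?K = card D + t"
    using card_Un_disjoint[OF fins(1,2) part(3)] D(3) by simp
  have "card (?K \<union> ?U) = card ?K + card ?U"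
    using fins part(2) by (intro card_Un_disjoint) auto
  then have cV: "card V = card D + t + u" using part(1) cK u_def by simp
  have st: "degree ?U y \<le> 1" if "y \<in> ?B" for y
    using fresh_degree_le_1[OF fin few D that] .
  have uniq: "z = z'" if "y \<in> ?B" "z \<in> ?U" "z' \<in> ?U" "adj y z" "adj y z'" for y z z'
    using unique_fresh_neighbour[OF fin st[OF that(1)]] that by blast
  have sigma: "joins ?B ?U = card S" unfolding S_def by (rule joins_eq_card[OF fins(2,3) st])
  have S_t: "card S \<le> t" using card_mono[OF fins(2), of S] D(3) unfolding S_def by auto
  have D0: "degree ?U v = 0" if "v \<in> D" for v
  proof -
    have "{z \<in> ?U. adj v z} = {}" using fresh_not_adj[OF that] by blast
    then show ?thesis unfolding degree_def by (simp only: card.empty)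
  qed
  have degU: "degree ?U v = of_bool (v \<in> S)" if "v \<in> ?K" for v
  proof (cases "v \<in> S")
    case True
    then have "degree ?U v \<noteq> 0" unfolding degree_def S_def using fins by auto
    moreover have "v \<in> ?B" using True unfolding S_def by blast
    ultimately show ?thesis using st[of v] True by simp
  next
    case False
    show ?thesis
    proof (cases "v \<in> D")
      case True
      then show ?thesis using D0 False by simp
    next
      case v: False
      then have "{z \<in> ?U. adj v z} = {}" using False that unfolding S_def by blast
      then have "degree ?U v = 0" unfolding degree_def by (simp only: card.empty)
      then show ?thesis using False by simp
    qed
  qed
  have dV: "joins ?K V + card S = darts V"
  proof -
    have "darts V = darts (?K \<union> ?U)" using part(1) by simp
    also have "\<dots> = darts ?K + darts ?U + 2 * joins ?K ?U"
      using fins part(2) by (intro darts_Un) auto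
    also have "\<dots> = darts ?K + 2 * card S" using U0 joins_fresh[OF fin D(2)] sigma by simp
    finally have "darts V = darts ?K + 2 * card S" .
    moreover have "joins ?K V = joins ?K (?K \<union> ?U)" using part(1) by simp
    moreover have "joins ?K (?K \<union> ?U) = darts ?K + card S"
      using fins part(2) joins_fresh[OF fin D(2)] sigma
      by (subst joins_Un_right) (auto simp: joins_self)
    ultimately show ?thesis by simp
  qed
  have KV: "?K \<subseteq> V" using D(2) unfolding boundary_def by blast
  have joinsK: "joins ?K V \<le> card ?K * d"
    unfolding joins_def using sum_bounded_above[of ?K "degree V" d] deg KV by auto
  obtain e where e: "d = e + 3" using d le_Suc_ex by (metis add.commute)
  have cD: "card D = p + 1"
  proof (rule ccontr)
    assume "card D \<noteq> p + 1"
    then have j: "card D \<le> p" using small by simp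
    have "2 * (card D + t + u) + t * (t - 1) \<le> (card D + t) * d + card S"
      using big dV joinsK cV cK by simp
    then show False by (rule small_tree_arithmetic[OF _ S_t j p(2,1) e])
  qed
  have cK': "card ?K = d + 2 * p + 1" using cK cD p by simp
  \<comment> \<open>Truncation is harmless, as \<open>d\<close> bounds all degrees.\<close>
  define gap where "gap v = d - degree V v" for v
  have gap: "degree V v + gap v = d" if "v \<in> V" for v using deg[OF that] by (simp add: gap_def)
  have sumgap: "joins ?K V + sum gap ?K = card ?K * d"
  proof -
    have "joins ?K V + sum gap ?K = (\<Sum>v\<in>?K. degree V v + gap v)"
      unfolding joins_def by (simp add: sum.distrib)
    also have "\<dots> = (\<Sum>v\<in>?K. d)" using gap KV by (intro sum.cong) auto
    finally show ?thesis by simp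
  qed
  have F: "sum gap ?K + 2 * u + (p + 1) * (p + 2) \<le> card S"
  proof -
    have "sum gap ?K + 2 * (card D + t + u) + t * (t - 1) \<le> card ?K * d + card S"
    proof -
      have "(sum gap ?K + a \<le> X + s)" if "a \<le> e" "J + s = e" "J + sum gap ?K = X" for a e s J X
        using that by simp
      from this[OF big dV sumgap] show ?thesis unfolding cV by simp
    qed
    then show ?thesis unfolding cK' cD p e by (simp add: algebra_simps)
  qed
  have "\<exists>x\<in>S. gap x = 0"
  proof (rule ccontr)
    assume "\<not> ?thesis"
    then have "card S \<le> sum gap S" using sum_mono[of S "\<lambda>_. 1" gap] by (simp add: Suc_leI)
    also have "\<dots> \<le> sum gap ?K" using fins unfolding S_def by (intro sum_mono2) auto
    finally show False using F by simp
  qed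
  then obtain x where x: "x \<in> S" "gap x = 0" by blast
  then obtain z where z: "z \<in> ?U" "adj x z" unfolding S_def by blast
  have xB: "x \<in> ?B" "x \<in> ?K" using x unfolding S_def by auto
  have codeg: "co.degree ?K v = 2 * p + gap v + of_bool (v \<in> S)" if "v \<in> ?K" for v
  proof -
    have "degree V v = degree (?K \<union> ?U) v" using part(1) by simp
    also have "\<dots> = degree ?K v + of_bool (v \<in> S)"
      using degree_Un[of ?K ?U v] fins part(2) degU[OF that] by simp
    finally show ?thesis using degree_co[OF fins(4) that] gap[of v] KV that cK' by auto
  qed
  define A where "A = {w \<in> ?K. co x w}"
  have A: "finite A" "A \<subseteq> ?K" "x \<notin> A" using fins unfolding A_def co_def by auto
  have cA: "card A = 2 * p + 1"
    using codeg[OF xB(2)] x unfolding A_def co.degree_def by simp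
  let ?Y = "?K - A - {x}"
  define Z where "Z = {y \<in> S. adj y z}"
  define R where "R = {y \<in> ?Y. y \<in> S \<and> \<not> adj y z}"
  \<comment> \<open>The boundary of \<open>{x, y}\<close> contains all of \<open>K\<close> except \<open>x\<close>, \<open>y\<close> and their common non-neighbours, and in
    addition \<open>z\<close>; for \<open>y\<close> in \<open>R\<close> it contains a second unreached vertex.\<close>
  have local: "p + of_bool (y \<in> R) \<le> co.degree A y" if y: "y \<in> ?Y" for y
  proof -
    have xy: "adj x y" "x \<noteq> y" using y unfolding A_def co_def by auto
    let ?N = "{w \<in> A. co y w}"
    let ?T = "{w \<in> ?U. adj x w \<or> adj y w}"
    have N: "?N \<subseteq> ?K - {x, y}" "finite ?N" using A unfolding co_def by auto
    have "?K - {x, y} - ?N \<union> ?T \<subseteq> boundary V {x, y}"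
    proof
      fix w assume w: "w \<in> ?K - {x, y} - ?N \<union> ?T"
      have "w \<in> V" "w \<noteq> x" "w \<noteq> y" using w part KV xB y by auto
      moreover have "adj x w \<or> adj y w" using w unfolding A_def co_def by auto
      ultimately show "w \<in> boundary V {x, y}" unfolding boundary_def by blast
    qed
    then have "card (?K - {x, y} - ?N \<union> ?T) \<le> card (boundary V {x, y})"
      by (intro card_mono finite_boundary[OF fin])
    also have "\<dots> \<le> t"
    proof -
      have "{x, y} \<subseteq> V" using xB y KV by blast
      then show ?thesis using few few_leavesD linked_pair[OF xy(1)] by blast
    qed
    finally have "card (?K - {x, y} - ?N \<union> ?T) \<le> t" .
    moreover have "card (?K - {x, y} - ?N \<union> ?T) = card (?K - {x, y} - ?N) + card ?T"
      using fins part(2) by (intro card_Un_disjoint) auto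
    moreover have "card (?K - {x, y} - ?N) + card ?N = card (?K - {x, y})"
      using N fins card_mono[of "?K - {x, y}" ?N] by (simp add: card_Diff_subset)
    moreover have "card (?K - {x, y}) + 2 = card ?K"
      using xy y xB card_Diff_subset[of "{x, y}" ?K] card_mono[of ?K "{x, y}"] fins by simp
    moreover have "1 + of_bool (y \<in> R) \<le> card ?T"
    proof (cases "y \<in> R")
      case True
      then obtain z' where z': "z' \<in> ?U" "adj y z'" "z' \<noteq> z" unfolding R_def S_def by blast
      have "card {z, z'} \<le> card ?T" using z z' fins by (intro card_mono) auto
      then show ?thesis using z' True by simp
    next
      case False
      have "card {z} \<le> card ?T" using z fins by (intro card_mono) auto
      then show ?thesis using False by simp
    qed
    moreover have "co.degree A y = card ?N" by (simp add: co.degree_def)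
    ultimately show ?thesis using cK' p(1) by linarith
  qed
  have "finite ?Y" using fins by simp
  have cY: "card ?Y + (2 * p + 1) + 1 = card ?K"
  proof -
    have "card ?Y + 1 = card (?K - A)"
      using card_Suc_Diff1[of "?K - A" x] fins A xB by simp
    moreover have "card (?K - A) + card A = card ?K"
      using A fins card_mono[of ?K A] by (simp add: card_Diff_subset)
    ultimately show ?thesis using cA by simp
  qed
  have "sum (\<lambda>y. p + of_bool (y \<in> R)) ?Y \<le> co.joins ?Y A"
    unfolding co.joins_def using local by (intro sum_mono) auto
  moreover have "sum (\<lambda>y. p + of_bool (y \<in> R)) ?Y = p * card ?Y + card R"
  proof -
    have "R = ?Y \<inter> R" unfolding R_def by blast
    then have "(\<Sum>y\<in>?Y. of_bool (y \<in> R)) = card R"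
      using \<open>finite ?Y\<close> by (simp add: Int_def[symmetric] Int_commute)
    then show ?thesis by (simp add: sum.distrib)
  qed
  ultimately have YA: "p * card ?Y + card R \<le> co.joins A ?Y"
    using co.joins_commute[OF \<open>finite ?Y\<close> A(1)] by simp
  have "co.joins A {x} = card A"
  proof -
    have "co.degree {x} w = 1" if "w \<in> A" for w
    proof -
      have "{v \<in> {x}. co w v} = {x}" using that co_sym unfolding A_def by blast
      then show ?thesis unfolding co.degree_def by simp
    qed
    then show ?thesis unfolding co.joins_def by simp
  qed
  moreover have "co.joins A (?Y \<union> {x}) = co.joins A ?Y + co.joins A {x}"
    using \<open>finite ?Y\<close> by (intro co.joins_Un_right) auto
  moreover have "co.joins A (?Y \<union> {x}) \<le> co.joins A ?K"
    unfolding co.joins_def using fins xB by (intro sum_mono co.degree_mono) auto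
  moreover have "co.joins A ?K = 2 * p * card A + sum gap A + card (A \<inter> S)"
  proof -
    have "co.joins A ?K = (\<Sum>w\<in>A. 2 * p + gap w + of_bool (w \<in> S))"
      unfolding co.joins_def using codeg A by (intro sum.cong) auto
    also have "\<dots> = 2 * p * card A + sum gap A + card (A \<inter> S)"
      using A(1) by (simp add: sum.distrib Int_def)
    finally show ?thesis .
  qed
  moreover have "sum gap A \<le> sum gap ?K" using A fins by (intro sum_mono2) auto
  ultimately have total: "p * card ?Y + card R + card A \<le> 2 * p * card A + sum gap ?K + card (A \<inter> S)"
    using YA by linarith
  \<comment> \<open>The vertices of \<open>S\<close> that may lie outside \<open>R\<close>, and so bring no bonus in \<open>local\<close>.\<close>
  let ?M = "Z \<union> (A \<inter> (S - Z))"
  have MS: "?M \<subseteq> S" unfolding Z_def by blast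
  have finM: "finite ?M" using MS fins finite_subset by blast
  show False
  proof (rule spread_arithmetic[of p t "card R" "sum gap ?K" "card (A \<inter> S)" u "card S" "card ?M"])
    show "1 \<le> p" by (rule p(2))
    show "p * t + (2 * p + 1) + card R
            \<le> 2 * p * (2 * p + 1) + sum gap ?K + card (A \<inter> S) + p * (p + 1)"
    proof -
      have "card ?Y + p + 1 = t" using cY cK' p(1) by simp
      then have "p * t = p * card ?Y + p * (p + 1)" by (metis add.assoc distrib_left)
      then show ?thesis using total cA by simp
    qed
    show "sum gap ?K + 2 * u + (p + 1) * (p + 2) \<le> card S" by (rule F)
    show "card S \<le> t" by (rule S_t)
    show "card (A \<inter> S) \<le> 2 * p + 1" using card_mono[OF A(1), of "A \<inter> S"] cA by simp
    show "card S \<le> card R + card ?M"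
    proof -
      have "S \<subseteq> R \<union> ?M"
        using x z unfolding R_def Z_def S_def by auto
      moreover have "finite R" using \<open>finite ?Y\<close> finite_subset[of R ?Y] unfolding R_def by blast
      ultimately have "card S \<le> card (R \<union> ?M)" using finM by (simp add: card_mono)
      then show ?thesis using card_Un_le[of R ?M] by linarith
    qed
    show "card ?M \<le> card S" using card_mono[OF fins(5) MS] .
    show "1 \<le> u" using z fins card_gt_0_iff[of ?U] unfolding u_def by auto
    \<comment> \<open>A single unreached vertex is adjacent to all of \<open>S\<close>, which bounds \<open>S\<close> by its degree.\<close>
    show "card ?M + p \<le> t" if u1: "u = 1"
    proof -
      have same: "z' = z" if "z' \<in> ?U" for z'
        using that z(1) u1 card_1_singletonE[of ?U] unfolding u_def by (metis singletonD)
      have Sz: "S \<subseteq> {v \<in> V. adj z v}"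
      proof
        fix v assume "v \<in> S"
        then obtain z' where "v \<in> ?B" "z' \<in> ?U" "adj v z'" unfolding S_def by blast
        then show "v \<in> {v \<in> V. adj z v}" using same[of z'] adj_sym[of v z] KV by auto
      qed
      have "card ?M \<le> degree V z"
        unfolding degree_def using fin by (intro card_mono subset_trans[OF MS Sz]) simp
      also have "\<dots> \<le> d" using deg z part(1) by blast
      finally show ?thesis using p(1) by simp
    qed
  qed
qed

section \<open>Many edges force a large boundary\<close>

text \<open>The assumption on triangles is restricted to \<open>card V \<ge> t + 4\<close> because
  contraction must not lead below order \<open>t + 3\<close>. At order \<open>t + 3\<close>
  the unreached part is small enough to be treated directly.\<close>

lemma edge_bound_step:
  assumes fin: "finite V" and V: "linked V" and few: "few_leaves V t" and t: "2 \<le> t"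
    and n: "t + 3 \<le> card V"
    and tri: "t + 4 \<le> card V \<Longrightarrow> (\<And>u v. u \<in> V \<Longrightarrow> v \<in> V \<Longrightarrow> adj u v \<Longrightarrow> \<exists>w\<in>V. adj u w \<and> adj v w)"
  shows "darts V < 2 * card V + t * (t - 1)"
proof (cases "\<forall>v\<in>V. degree V v \<le> 2")
  case True
  then have "darts V \<le> card V * 2"
    unfolding darts_def using sum_bounded_above[of V "degree V" 2] by simp
  moreover have "0 < t * (t - 1)" using t by simp
  ultimately show ?thesis by linarith
next
  case False
  then obtain v where v: "v \<in> V" "3 \<le> degree V v" by fastforce
  define d where "d = Max (degree V ` V)"
  have deg: "degree V v \<le> d" if "v \<in> V" for v using that fin by (simp add: d_def)
  have d3: "3 \<le> d" using v deg by (meson order_trans)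
  have "d \<in> degree V ` V" unfolding d_def using fin v by (intro Max_in) auto
  then obtain r where r: "r \<in> V" "degree V r = d" by blast
  obtain D where D: "linked D" "D \<subseteq> V" "card D + d \<le> card (boundary V D) + 1"
    and stall: "\<And>y. y \<in> boundary V D \<Longrightarrow> degree (fresh V D) y \<le> 1"
    using stalled_tree_exists[OF fin r(1)] r(2) by blast
  let ?b = "card (boundary V D)" and ?U = "fresh V D"
  note part = boundary_fresh_partition[OF D(2)]
  have fins: "finite D" "finite (boundary V D)" "finite ?U"
    using fin D(2) finite_boundary finite_fresh finite_subset by auto
  have "D \<noteq> {}" using D linked_nonempty by blast
  then have j1: "1 \<le> card D" using fins by (simp add: Suc_leI card_gt_0_iff)
  have bt: "?b \<le> t" using few few_leavesD D by blast
  have bd: "d \<le> ?b" using D(3) j1 by linarith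
  have "card (D \<union> boundary V D) = card D + ?b"
    using fins part(3) by (intro card_Un_disjoint) auto
  moreover have "card V = card (D \<union> boundary V D) + card ?U"
    using part(1,2) fins by (metis card_Un_disjoint finite_UnI)
  ultimately have cV: "card V = card D + ?b + card ?U" by simp
  show ?thesis
  proof (cases "?b = t")
    case False
    then obtain q where q: "t = ?b + q" "1 \<le> q" using bt le_Suc_ex by (metis add_0_right less_one not_le)
    have U: "darts ?U \<le> 2 * card ?U + q\<^sup>2 + 4 * q"
    proof (rule darts_fresh_le[OF fin D(2,1), THEN conjunct1])
      show "\<exists>x\<in>X. \<exists>y\<in>V - X. adj x y" if "X \<subseteq> ?U" "X \<noteq> {}" for X
        using fresh_reached[OF V D(2) \<open>D \<noteq> {}\<close> that] by blast
      show "card (boundary V E) \<le> ?b + q" if "linked E" "D \<subseteq> E" "E \<subseteq> V" for E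
        using few_leavesD[OF few that(1,3)] q by simp
      show "darts C + 4 \<le> 2 * card C + k\<^sup>2"
        if "C \<subseteq> ?U" "linked C" "2 \<le> k" "few_leaves C k" for C k
        using edge_bound_all_orders[of C k] that fins finite_subset by blast
    qed
    have total: "darts V \<le> (card D + ?b) * d + joins (boundary V D) ?U + darts ?U"
      by (rule darts_le_by_tree[OF fin D(2) deg])
    have sigma: "joins (boundary V D) ?U \<le> ?b" by (rule joins_le_card[OF stall])
    have "darts V < 2 * card V + (?b + q) * (?b + q - 1)"
      using combine_counts_strict[OF total tree_count_bound[OF d3 D(3) bd] cV U
          even_darts[OF fins(3)] sigma order_trans[OF d3 bd] q(2)] .
    then show ?thesis using q(1) by simp
  next
    case b: True
    obtain p where p: "t = d + p" using bd b le_Suc_ex by blast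
    have edgeless: "darts ?U = 0" if "t + 4 \<le> card V"
      using fresh_edgeless[OF fin V few D(1,2) b] tri[OF that] by blast
    show ?thesis
    proof (cases "card D = 1")
      case True
      then obtain r' where r': "D = {r'}" using card_1_singletonE by blast
      have "r' \<in> V" "degree V r' = t" using D(2) b r' by (simp_all add: card_boundary_singleton)
      moreover have "darts (fresh V {r'}) = 0 \<or> card (fresh V {r'}) = 2"
        using edgeless cV b n True unfolding r' by linarith
      ultimately show ?thesis using hub_bound[OF fin V few _ _ n] by blast
    next
      case False
      have "darts ?U = 0"
      proof (cases "t + 4 \<le> card V")
        case True
        then show ?thesis by (rule edgeless)
      next
        case no: False
        have "card ?U \<le> 1" using no cV b j1 False n by linarith
        then have "card ?U * (card ?U - 1) = 0" by (cases "card ?U") auto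
        then show ?thesis using darts_co[OF fins(3)] by linarith
      qed
      moreover have "1 \<le> p" "card D \<le> p + 1" using D(3) b p j1 False by linarith+
      ultimately show ?thesis
        using spread_bound[OF fin few D(1,2) b deg d3 p] by blast
    qed
  qed
qed

end

text \<open>The theorem of Ding, Johnson and Seymour. The relation varies in the induction, as contracting
  an edge changes it.\<close>

theorem edge_bound:
  assumes "adjacency adj" and "finite V" and "adjacency.linked adj V"
    and "adjacency.few_leaves adj V t" and "2 \<le> t" and "t + 3 \<le> card V"
  shows "adjacency.darts adj V < 2 * card V + t * (t - 1)"
  using assms
proof (induction "card V" arbitrary: V adj rule: less_induct)
  case less
  interpret complemented adj by (rule complemented.intro[OF less.prems(1)])
  note V = less.prems(2-6)
  show ?case
  proof (cases "t + 4 \<le> card V \<and> (\<exists>u\<in>V. \<exists>v\<in>V. adj u v \<and> (\<forall>w\<in>V. adj u w \<longrightarrow> \<not> adj v w))")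
    case True
    then obtain u v where uv: "u \<in> V" "v \<in> V" "adj u v"
      and no: "\<And>w. w \<in> V \<Longrightarrow> adj u w \<Longrightarrow> \<not> adj v w" by blast
    have c: "card (V - {v}) + 1 = card V"
      using V(1) uv by (metis Suc_eq_plus1 card_Suc_Diff1)
    have "adjacency.darts (contract adj u v) (V - {v}) < 2 * card (V - {v}) + t * (t - 1)"
    proof (rule less.hyps)
      show "card (V - {v}) < card V" using c by simp
      show "adjacency (contract adj u v)" by (rule adjacency_contract)
      show "finite (V - {v})" using V by simp
      show "adjacency.linked (contract adj u v) (V - {v})" by (rule linked_contract[OF V(2) uv])
      show "adjacency.few_leaves (contract adj u v) (V - {v}) t"
        by (rule few_leaves_contract[OF V(1,3) uv])
      show "2 \<le> t" by (rule V(4))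
      show "t + 3 \<le> card (V - {v})" using True c by linarith
    qed
    then show ?thesis using darts_contract[OF V(1) uv no] c by linarith
  next
    case False
    show ?thesis
    proof (rule edge_bound_step[OF V])
      fix u v assume "t + 4 \<le> card V" "u \<in> V" "v \<in> V" "adj u v"
      then show "\<exists>w\<in>V. adj u w \<and> adj v w" using False by blast
    qed
  qed
qed


section \<open>Paths, degrees and colourings\<close>

lemma path_exit:
  assumes p: "path_between V E u p v" and uv: "u \<in> S" "v \<notin> S"
  obtains a b where "a \<in> S" "b \<notin> S" "{a, b} \<in> E" "a \<in> set p" "b \<in> set p"
proof -
  have "\<exists>a b. a \<in> S \<and> b \<notin> S \<and> {a, b} \<in> E \<and> a \<in> set q \<and> b \<in> set q"
    if "q \<noteq> []" "successively (\<lambda>x y. {x, y} \<in> E) q" "hd q \<in> S" "last q \<notin> S" for q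
    using that
  proof (induction q)
    case (Cons x q)
    show ?case
    proof (cases q)
      case Nil
      then show ?thesis using Cons.prems by simp
    next
      case (Cons y ys)
      note q = this
      have e: "{x, y} \<in> E" "successively (\<lambda>x y. {x, y} \<in> E) q" using Cons.prems q by auto
      show ?thesis
      proof (cases "y \<in> S")
        case True
        then show ?thesis using Cons.IH e Cons.prems q by auto
      next
        case False
        then show ?thesis using e Cons.prems q by auto
      qed
    qed
  qed simp
  from this[of p] show ?thesis using p uv that unfolding path_between_def by auto
qed

lemma set_path_subset:
  assumes "path_between V E u p v"
  shows "set p \<subseteq> insert u (insert v (internal_vertices p))"
proof
  fix x assume x: "x \<in> set p"
  have p: "p \<noteq> []" "hd p = u" "last p = v" using assms unfolding path_between_def by auto
  then obtain q where q: "p = u # q" by (cases p) auto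
  show "x \<in> insert u (insert v (internal_vertices p))"
  proof (cases "q = []")
    case True
    then show ?thesis using x q by simp
  next
    case False
    then have "q = butlast q @ [v]" using p(3) q append_butlast_last_id[of q] by simp
    then have "set q = insert v (set (butlast q))"
      by (metis set_append Un_insert_right empty_set list.simps(15) sup_bot.right_neutral)
    then show ?thesis using x q unfolding internal_vertices_def by auto
  qed
qed

text \<open>The inequality makes the relation irreflexive for an arbitrary set of edges, so that every set
  of edges yields an adjacency relation.\<close>

definition edge_rel :: "'a set set \<Rightarrow> 'a \<Rightarrow> 'a \<Rightarrow> bool" where
  "edge_rel E x y \<longleftrightarrow> x \<noteq> y \<and> {x, y} \<in> E"

lemma complemented_edge_rel: "complemented (edge_rel E)"
  by unfold_locales (auto simp: edge_rel_def insert_commute)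

interpretation g: complemented "edge_rel E" for E
  by (rule complemented_edge_rel)

lemma connected_imp_linked:
  assumes "connected_graph V E"
  shows "g.linked E V"
proof (rule g.linkedI)
  show "V \<noteq> {}" using assms unfolding connected_graph_def by blast
next
  fix X assume X: "X \<subseteq> V" "X \<noteq> {}" "X \<noteq> V"
  then obtain u v where uv: "u \<in> X" "v \<in> V" "v \<notin> X" by blast
  then obtain p where p: "path_between V E u p v"
    using assms X unfolding connected_graph_def by blast
  obtain a b where ab: "a \<in> X" "b \<notin> X" "{a, b} \<in> E" "b \<in> set p"
    using path_exit[OF p uv(1,3)] by metis
  then have "b \<in> V" using p unfolding path_between_def by blast
  moreover have "edge_rel E a b" using ab unfolding edge_rel_def by auto
  ultimately show "\<exists>x\<in>X. \<exists>y\<in>V - X. edge_rel E x y" using ab by blast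
qed

text \<open>The set of vertices that can be reached by a path is not left by any edge. A path that already
  visits the new vertex is cut off there.\<close>

lemma linked_path:
  assumes D: "g.linked E D" and a: "a \<in> D" and b: "b \<in> D"
  obtains p where "path_between D E a p b"
proof -
  let ?R = "{w \<in> D. \<exists>p. path_between D E a p w}"
  have "path_between D E a [a] a" using a unfolding path_between_def by simp
  then have aR: "a \<in> ?R" using a by blast
  have "?R = D"
  proof (rule ccontr)
    assume ne: "?R \<noteq> D"
    have R: "?R \<subseteq> D" "?R \<noteq> {}" using aR by blast+
    obtain x y where xy: "x \<in> ?R" "y \<in> D" "y \<notin> ?R" "edge_rel E x y"
      by (rule g.linked_cut[OF D R ne])
    then obtain p where p: "path_between D E a p x" by blast
    show False
    proof (cases "y \<in> set p")
      case True
      then obtain q r where "p = q @ y # r" by (meson split_list)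
      then have q: "p = (q @ [y]) @ r" by simp
      have "successively (\<lambda>x y. {x, y} \<in> E) (q @ [y])"
        using p unfolding path_between_def q by (metis successively_append_iff)
      moreover have "hd (q @ [y]) = a" using p unfolding path_between_def q by (cases q) auto
      ultimately have "path_between D E a (q @ [y]) y"
        using p unfolding path_between_def q by auto
      then show False using xy by blast
    next
      case False
      then have "path_between D E a (p @ [y]) y"
        using p xy unfolding path_between_def edge_rel_def by (auto simp: successively_append_iff)
      then show False using xy by blast
    qed
  qed
  then show ?thesis using b that by blast
qed

lemma linked_imp_connected:
  assumes "simple_graph V E" "g.linked E V"
  shows "connected_graph V E"
proof -
  have "\<exists>p. path_between V E u p v" if "u \<in> V" "v \<in> V" for u v
    using linked_path[OF assms(2) that] by blast
  then show ?thesis unfolding connected_graph_def using assms g.linked_nonempty by blast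
qed

lemma handshake:
  assumes "simple_graph V E"
  shows "g.darts E V = 2 * card E"
proof -
  have fin: "finite V" and E: "\<And>e. e \<in> E \<Longrightarrow> e \<subseteq> V \<and> card e = 2"
    using assms unfolding simple_graph_def by auto
  have finE: "finite E" using E fin by (meson Pow_iff finite_Pow_iff finite_subset subsetI)
  have star: "g.degree E V v = card {e \<in> E. v \<in> e}" if "v \<in> V" for v
  proof -
    have "bij_betw (\<lambda>u. {v, u}) {u \<in> V. edge_rel E v u} {e \<in> E. v \<in> e}"
    proof (rule bij_betw_imageI)
      show "inj_on (\<lambda>u. {v, u}) {u \<in> V. edge_rel E v u}"
        by (auto simp: inj_on_def doubleton_eq_iff)
      show "(\<lambda>u. {v, u}) ` {u \<in> V. edge_rel E v u} = {e \<in> E. v \<in> e}"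
      proof (intro subset_antisym subsetI)
        fix e assume e: "e \<in> {e \<in> E. v \<in> e}"
        then obtain x y where xy: "e = {x, y}" "x \<noteq> y" using E by (metis (mono_tags, lifting) card_2_iff mem_Collect_eq)
        define u where "u = (if v = x then y else x)"
        have "e = {v, u}" "u \<noteq> v" using xy e unfolding u_def by auto
        moreover have "u \<in> V" using E[of e] e \<open>e = {v, u}\<close> by blast
        ultimately show "e \<in> (\<lambda>u. {v, u}) ` {u \<in> V. edge_rel E v u}"
          using e unfolding edge_rel_def by blast
      qed (auto simp: edge_rel_def)
    qed
    then show ?thesis unfolding g.degree_def by (rule bij_betw_same_card)
  qed
  have "g.darts E V = (\<Sum>v\<in>V. \<Sum>e\<in>E. of_bool (v \<in> e))"
    unfolding g.darts_def using star finE by (intro sum.cong) (auto simp: Int_def)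
  also have "\<dots> = (\<Sum>e\<in>E. \<Sum>v\<in>V. of_bool (v \<in> e))" by (rule sum.swap)
  also have "\<dots> = (\<Sum>e\<in>E. 2)"
  proof (rule sum.cong[OF refl])
    fix e assume "e \<in> E"
    then have "V \<inter> e = e" "card e = 2" using E by blast+
    then show "(\<Sum>v\<in>V. of_bool (v \<in> e)) = (2::nat)" using fin by simp
  qed
  finally show ?thesis by simp
qed

lemma mvc_ge:
  fixes c :: "'a \<Rightarrow> nat"
  assumes "finite V" "MVC_coloring V E c"
  shows "card (c ` V) \<le> mvc V E"
proof -
  have "{card (c ` V) | c :: 'a \<Rightarrow> nat. MVC_coloring V E c} \<subseteq> {..card V}"
    using card_image_le[OF assms(1)] by auto
  then show ?thesis
    unfolding mvc_def using assms by (intro Max_ge) (auto intro: finite_subset)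
qed

text \<open>Constant colourings show that the maximum is taken over a nonempty set.\<close>

lemma mvc_le:
  assumes G: "connected_graph V E"
    and le: "\<And>c :: 'a \<Rightarrow> nat. MVC_coloring V E c \<Longrightarrow> card (c ` V) \<le> m"
  shows "mvc V E \<le> m"
proof -
  have fin: "finite V" using G unfolding connected_graph_def simple_graph_def by blast
  let ?S = "{card (c ` V) | c :: 'a \<Rightarrow> nat. MVC_coloring V E c}"
  have "MVC_coloring V E (\<lambda>_. 0 :: nat)"
    using G unfolding connected_graph_def MVC_coloring_def vertex_monochromatic_def by auto
  then have "?S \<noteq> {}" by blast
  moreover have "finite ?S"
    using card_image_le[OF fin] by (auto intro: finite_subset[of _ "{..card V}"])
  ultimately have "Max ?S \<in> ?S" by (rule Max_in[rotated])
  then show ?thesis unfolding mvc_def using le by auto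
qed

text \<open>Any two vertices are joined by a path whose internal vertices lie in a connected dominating set,
  so that this set can be coloured uniformly and all other vertices arbitrarily.\<close>

lemma boundary_mvc:
  assumes G: "connected_graph V E" and D: "g.linked E D" "D \<subseteq> V"
  shows "card (g.boundary E V D) + 1 \<le> mvc V E"
proof -
  have simple: "simple_graph V E" and fin: "finite V"
    using G unfolding connected_graph_def simple_graph_def by auto
  obtain T where T: "D \<subseteq> T" "T \<subseteq> V" "g.linked E T" "V - T = g.boundary E V T"
    "card (g.boundary E V D) \<le> card (g.boundary E V T)"
    using g.dominating_extension[OF fin connected_imp_linked[OF G] D] by blast
  obtain f :: "'a \<Rightarrow> nat" where f: "inj_on f V"
    using finite_imp_inj_to_nat_seg[OF fin] by blast
  define c where "c v = (if v \<in> T then 0 else Suc (f v))" for v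
  have "T \<noteq> {}" using T(3) g.linked_nonempty by blast
  then have "c ` V = insert 0 ((\<lambda>v. Suc (f v)) ` (V - T))"
    using T(2) unfolding c_def by (auto simp: image_iff)
  moreover have "card ((\<lambda>v. Suc (f v)) ` (V - T)) = card (V - T)"
    using f by (intro card_image) (auto simp: inj_on_def)
  ultimately have cc: "card (c ` V) = card (V - T) + 1" using fin by (simp add: card_insert_if image_iff)
  have anchor: "\<exists>t\<in>T. v = t \<or> edge_rel E t v" if "v \<in> V" for v
  proof (cases "v \<in> T")
    case False
    then have "v \<in> g.boundary E V T" using T(4) that by blast
    then show ?thesis unfolding g.boundary_def by blast
  qed blast
  have "MVC_coloring V E c"
    unfolding MVC_coloring_def
  proof (intro ballI)
    fix u v assume uv: "u \<in> V" "v \<in> V"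
    show "\<exists>p. path_between V E u p v \<and> vertex_monochromatic c p"
    proof (cases "u = v")
      case True
      then have "path_between V E u [u] v" "vertex_monochromatic c [u]"
        using uv unfolding path_between_def vertex_monochromatic_def internal_vertices_def by auto
      then show ?thesis by blast
    next
      case False
      obtain s where s: "s \<in> T" "u \<in> T \<Longrightarrow> u = s" "u \<notin> T \<Longrightarrow> edge_rel E s u"
        using anchor[OF uv(1)] by blast
      obtain t where t: "t \<in> T" "v \<in> T \<Longrightarrow> v = t" "v \<notin> T \<Longrightarrow> edge_rel E t v"
        using anchor[OF uv(2)] by blast
      obtain p where p: "path_between T E s p t" using linked_path[OF T(3) s(1) t(1)] .
      let ?q = "(if u \<in> T then [] else [u]) @ p @ (if v \<in> T then [] else [v])"
      have pT: "p \<noteq> []" "distinct p" "set p \<subseteq> T" "successively (\<lambda>x y. {x, y} \<in> E) p"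
        "hd p = s" "last p = t"
        using p unfolding path_between_def by auto
      have su: "u \<notin> T \<Longrightarrow> {u, s} \<in> E" and tv: "v \<notin> T \<Longrightarrow> {t, v} \<in> E"
        using s(3) t(3) unfolding edge_rel_def by (auto simp: insert_commute)
      have "path_between V E u ?q v"
        unfolding path_between_def
        using pT s(2) t(2) su tv uv T(2) False
        by (auto simp: successively_append_iff successively_Cons hd_append)
      moreover have "internal_vertices ?q \<subseteq> set p"
      proof -
        have shrink: "set (butlast xs) \<subseteq> set xs" "set (tl xs) \<subseteq> set xs" for xs :: "'a list"
          by (auto dest: in_set_butlastD) (cases xs, auto)
        have "set (butlast p) \<subseteq> set p" "set (tl p) \<subseteq> set p" "set (butlast (tl p)) \<subseteq> set p"
          using shrink by blast+
        then show ?thesis unfolding internal_vertices_def using pT(1)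
          by (auto simp: butlast_append)
      qed
      then have "vertex_monochromatic c ?q"
        using pT(3) unfolding vertex_monochromatic_def c_def by (metis subsetD)
      ultimately show ?thesis by blast
    qed
  qed
  then have "card (V - T) + 1 \<le> mvc V E" using mvc_ge[OF fin] cc by metis
  then show ?thesis using T(4,5) by simp
qed

lemma rainbow_mvc:
  assumes fin: "finite V"
    and near: "\<And>u v. u \<in> V \<Longrightarrow> v \<in> V \<Longrightarrow> u \<noteq> v \<Longrightarrow> \<not> edge_rel E u v \<Longrightarrow>
                 \<exists>w\<in>V. edge_rel E u w \<and> edge_rel E v w"
  shows "card V \<le> mvc V E"
proof -
  obtain f :: "'a \<Rightarrow> nat" where f: "inj_on f V"
    using finite_imp_inj_to_nat_seg[OF fin] by blast
  have "MVC_coloring V E f"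
    unfolding MVC_coloring_def
  proof (intro ballI)
    fix u v assume uv: "u \<in> V" "v \<in> V"
    consider "u = v" | "edge_rel E u v" | w where "u \<noteq> v" "w \<in> V" "edge_rel E u w" "edge_rel E v w"
      using near[OF uv] by blast
    then show "\<exists>p. path_between V E u p v \<and> vertex_monochromatic f p"
    proof cases
      case 1
      then have "path_between V E u [u] v \<and> vertex_monochromatic f [u]"
        using uv unfolding path_between_def vertex_monochromatic_def internal_vertices_def by simp
      then show ?thesis by blast
    next
      case 2
      then have "path_between V E u [u, v] v \<and> vertex_monochromatic f [u, v]"
        using uv unfolding path_between_def vertex_monochromatic_def internal_vertices_def edge_rel_def
        by simp
      then show ?thesis by blast
    next
      case 3
      then have "path_between V E u [u, w, v] v \<and> vertex_monochromatic f [u, w, v]"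
        using uv unfolding path_between_def vertex_monochromatic_def internal_vertices_def edge_rel_def
        by (auto simp: insert_commute)
      then show ?thesis by blast
    qed
  qed
  then have "card (f ` V) \<le> mvc V E" by (rule mvc_ge[OF fin])
  then show ?thesis using f by (simp add: card_image)
qed


section \<open>Lower bounds for mvc\<close>

lemma twice_choose_two: "2 * (n choose 2) = n * (n - 1)"
proof -
  have "even (n * (n - 1))" by (cases n) auto
  then show ?thesis by (simp add: choose_two)
qed

context complemented
begin

text \<open>The edges of the complement at \<open>a\<close> and \<open>b\<close>, counted through the edges
  that are present.\<close>

lemma far_pair_darts:
  assumes fin: "finite V" and ab: "a \<in> V" "b \<in> V" "a \<noteq> b" "\<not> adj a b"
  shows "co.darts V + 2 * (degree (V - {a, b}) a + degree (V - {a, b}) b)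
           = co.darts (V - {a, b}) + 4 * card (V - {a, b}) + 2"
proof -
  define W where "W = V - {a, b}"
  have W: "finite W" "b \<notin> W" "a \<notin> insert b W" "V = insert a (insert b W)"
    using fin ab unfolding W_def by auto
  have miss: "degree W v + co.degree W v = card W" if "v \<notin> W" for v
  proof -
    have "card {u \<in> W. adj v u} + card {u \<in> W. co v u} = card ({u \<in> W. adj v u} \<union> {u \<in> W. co v u})"
      using W(1) by (intro card_Un_disjoint[symmetric]) (auto simp: co_def)
    also have "{u \<in> W. adj v u} \<union> {u \<in> W. co v u} = W" using that unfolding co_def by auto
    finally show ?thesis by (simp add: degree_def co.degree_def)
  qed
  have "co.degree (insert b W) a = co.degree W a + 1"
  proof -
    have "{u \<in> insert b W. co a u} = insert b {u \<in> W. co a u}" using ab unfolding co_def by auto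
    then show ?thesis unfolding co.degree_def using W(1,2) by simp
  qed
  moreover have "co.darts V = co.darts W + 2 * co.degree W b + 2 * co.degree (insert b W) a"
    unfolding W(4) using co.darts_insert[of "insert b W" a] co.darts_insert[of W b] W by simp
  ultimately show ?thesis
    using miss[of a] miss[of b] W(2,3) unfolding W_def[symmetric] by simp
qed

lemma degree_sum_disjoint:
  assumes "finite W" "\<And>w. w \<in> W \<Longrightarrow> adj a w \<Longrightarrow> \<not> adj b w"
  shows "degree W a + degree W b = card ({w \<in> W. adj a w} \<union> {w \<in> W. adj b w})"
proof -
  have "{w \<in> W. adj a w} \<inter> {w \<in> W. adj b w} = {}" using assms(2) by blast
  then show ?thesis
    using assms(1) by (simp add: card_Un_disjoint degree_def)
qed

text \<open>A non-adjacent pair without a common neighbour causes a missing edge at every other vertex.\<close>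

lemma diameter_two:
  assumes fin: "finite V" and few: "co.darts V + 4 \<le> 2 * card V"
    and ab: "a \<in> V" "b \<in> V" "a \<noteq> b" "\<not> adj a b"
  shows "\<exists>w\<in>V. adj a w \<and> adj b w"
proof (rule ccontr)
  assume no: "\<not> ?thesis"
  let ?W = "V - {a, b}"
  have "degree ?W a + degree ?W b = card ({w \<in> ?W. adj a w} \<union> {w \<in> ?W. adj b w})"
    using no fin by (intro degree_sum_disjoint) auto
  also have "\<dots> \<le> card ?W" using fin by (intro card_mono) auto
  finally have D: "degree ?W a + degree ?W b \<le> card ?W" .
  have W: "card ?W + 2 = card V"
    using ab fin card_mono[of V "{a, b}"] by (simp add: card_Diff_subset)
  have False if "D \<le> w" "w + 2 = n" "e + 2 * D = m + 4 * w + 2" "e + 4 \<le> 2 * n"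
    for D w n e m :: nat
    using that by presburger
  from this[OF D W far_pair_darts[OF fin ab] few] show False .
qed

text \<open>Let \<open>a\<close> and \<open>b\<close> be non-adjacent without a common neighbour. So few
  edges are missing elsewhere that the neighbours of \<open>a\<close> and of \<open>b\<close>
  cannot all lie in one component of the complement of the graph on
  \<open>V - {a, b}\<close>. Choose a neighbour \<open>x\<close> of \<open>a\<close> and a
  neighbour \<open>y\<close> of \<open>b\<close> in different components: they are adjacent, and
  no vertex misses both of them.\<close>

lemma dominating_edge:
  assumes fin: "finite V" and V: "linked V" and few: "co.darts V + 10 \<le> 4 * card V"
    and ab: "a \<in> V" "b \<in> V" "a \<noteq> b" "\<not> adj a b"
    and no: "\<And>w. w \<in> V \<Longrightarrow> adj a w \<Longrightarrow> \<not> adj b w"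
  obtains x y where "x \<in> V" "y \<in> V" "adj x y" "V - {x, y} \<subseteq> boundary V {x, y}"
proof -
  let ?W = "V - {a, b}"
  let ?A = "{w \<in> ?W. adj a w}" and ?B = "{w \<in> ?W. adj b w}"
  have finW: "finite ?W" using fin by simp
  have cW: "card ?W + 2 = card V"
    using ab fin card_mono[of V "{a, b}"] by (simp add: card_Diff_subset)
  have AB: "degree ?W a + degree ?W b = card (?A \<union> ?B)"
    using no fin by (intro degree_sum_disjoint) auto
  have sparse: "co.darts ?W + 4 \<le> 2 * card (?A \<union> ?B)"
    using far_pair_darts[OF fin ab] few cW AB by arith
  have "{a} \<subseteq> V" "{a} \<noteq> {}" "{a} \<noteq> V" using ab by auto
  then obtain x0 where x0: "x0 \<in> V" "x0 \<noteq> a" "adj a x0"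
    using linked_cut[OF V, of "{a}"] by blast
  then have x0A: "x0 \<in> ?A" using ab(4) by blast
  have "{b} \<subseteq> V" "{b} \<noteq> {}" "{b} \<noteq> V" using ab by auto
  then obtain y0 where y0: "y0 \<in> V" "y0 \<noteq> b" "adj b y0"
    using linked_cut[OF V, of "{b}"] by blast
  then have y0B: "y0 \<in> ?B" using ab(4) adj_sym[of b y0] by blast
  obtain C where C: "x0 \<in> C" "C \<subseteq> ?W" "co.linked C"
    and sep: "\<And>x y. x \<in> C \<Longrightarrow> y \<in> ?W - C \<Longrightarrow> \<not> co x y"
    using co.component_exists[OF finW] x0A by blast
  have "\<not> ?A \<union> ?B \<subseteq> C"
  proof
    assume sub: "?A \<union> ?B \<subseteq> C"
    have finC: "finite C" using C finW finite_subset by blast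
    have "card (?A \<union> ?B) \<le> card C" by (rule card_mono[OF finC sub])
    moreover have "2 * card C \<le> co.darts C + 2" by (rule co.darts_linked_ge[OF finC C(3)])
    moreover have "co.darts C \<le> co.darts ?W" by (rule co.darts_mono[OF finW C(2)])
    ultimately show False using sparse by linarith
  qed
  then obtain x y where xy: "x \<in> ?A" "y \<in> ?B" "x \<in> C \<longleftrightarrow> y \<notin> C"
    using C(1) x0A y0B by blast
  have split: "\<not> (co x w \<and> co w y)" if "w \<in> ?W" for w
    using xy sep[of x w] sep[of w y] sep[of w x] sep[of y w] co_sym[of x w] co_sym[of w y] that
    by blast
  have "x \<noteq> y" using xy by blast
  moreover have "\<not> co x y" using xy sep[of x y] sep[of y x] co_sym[of x y] by blast
  ultimately have "adj x y" unfolding co_def by blast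
  moreover have "V - {x, y} \<subseteq> boundary V {x, y}"
  proof
    fix w assume w: "w \<in> V - {x, y}"
    have "adj x w \<or> adj y w"
    proof (cases "w = a \<or> w = b")
      case True
      then show ?thesis using xy adj_sym by blast
    next
      case False
      then have "\<not> co x w \<or> \<not> co w y" using split w by blast
      then show ?thesis using w adj_sym unfolding co_def by blast
    qed
    then show "w \<in> boundary V {x, y}" using w unfolding boundary_def by blast
  qed
  ultimately show ?thesis using that xy by blast
qed

end

lemma connected_darts:
  assumes "connected_graph V E"
  shows "finite V" "g.linked E V" "g.darts E V = 2 * card E"
    "2 * card E + g.co.darts E V = card V * (card V - 1)"
proof -
  have s: "simple_graph V E" using assms unfolding connected_graph_def by blast
  then show fin: "finite V" unfolding simple_graph_def by blast
  show "g.linked E V" by (rule connected_imp_linked[OF assms])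
  show d: "g.darts E V = 2 * card E" by (rule handshake[OF s])
  show "2 * card E + g.co.darts E V = card V * (card V - 1)" using g.darts_co[OF fin, of E] d by simp
qed

text \<open>A connected graph on three vertices or more has a vertex of degree at least two.\<close>

lemma mvc_ge_3:
  assumes G: "connected_graph V E" and n: "3 \<le> card V"
  shows "3 \<le> mvc V E"
proof -
  note c = connected_darts[OF G]
  have "\<not> g.few_leaves E V 1"
  proof
    assume few: "g.few_leaves E V 1"
    obtain v where v: "v \<in> V" using n by fastforce
    obtain w where w: "w \<in> V" "w \<noteq> v" "edge_rel E v w"
    proof -
      have "{v} \<subseteq> V" "{v} \<noteq> {}" "{v} \<noteq> V" using v n by auto
      then show ?thesis using g.linked_cut[OF c(2), of "{v}"] that by blast
    qed
    have "{v, w} \<subseteq> V" "{v, w} \<noteq> {}" "{v, w} \<noteq> V" using v w n card_2_iff[of V] by auto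
    then obtain x y where xy: "x \<in> {v, w}" "y \<in> V" "y \<notin> {v, w}" "edge_rel E x y"
      using g.linked_cut[OF c(2), of "{v, w}"] by blast
    define x' where "x' = (if x = v then w else v)"
    have "{x', y} \<subseteq> {u \<in> V. edge_rel E x u}" "x' \<noteq> y"
      using xy v w g.adj_sym[of E v w] unfolding x'_def by auto
    then have "2 \<le> g.degree E V x"
      unfolding g.degree_def using card_mono[of "{u \<in> V. edge_rel E x u}" "{x', y}"] c(1) by simp
    moreover have "x \<in> V" using xy v w by blast
    ultimately show False using g.few_leaves_degree[OF few, of x] by simp
  qed
  then obtain D where "g.linked E D" "D \<subseteq> V" "2 \<le> card (g.boundary E V D)"
    unfolding g.few_leaves_def by fastforce
  then show ?thesis using boundary_mvc[OF G, of D] by linarith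
qed

text \<open>Otherwise every connected set would have at most \<open>k - 2\<close> boundary vertices,
  against \<open>edge_bound\<close>.\<close>

lemma mvc_ge_general:
  assumes G: "connected_graph V E" and k: "4 \<le> k" "k + 1 \<le> card V"
    and e: "card V + ((k - 2) choose 2) \<le> card E"
  shows "k \<le> mvc V E"
proof -
  note c = connected_darts[OF G]
  have "\<not> g.few_leaves E V (k - 2)"
  proof
    assume "g.few_leaves E V (k - 2)"
    then have "g.darts E V < 2 * card V + (k - 2) * (k - 2 - 1)"
      using c k by (intro edge_bound g.adjacency_axioms) auto
    then show False using c(3) e twice_choose_two[of "k - 2"] by linarith
  qed
  then obtain D where "g.linked E D" "D \<subseteq> V" "k - 1 \<le> card (g.boundary E V D)"
    unfolding g.few_leaves_def by fastforce
  then show ?thesis using boundary_mvc[OF G, of D] k by linarith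
qed

text \<open>The edge count makes the diameter at most two, and then pairwise different colours are allowed.\<close>

lemma mvc_ge_card:
  assumes G: "connected_graph V E" and n: "3 \<le> card V"
    and e: "card V - 1 + ((card V - 2) choose 2) \<le> card E"
  shows "card V \<le> mvc V E"
proof -
  note c = connected_darts[OF G]
  obtain m where m: "card V = m + 3" using n le_Suc_ex by (metis add.commute)
  have "2 * ((m + 1) choose 2) = (m + 1) * m" using twice_choose_two[of "m + 1"] by simp
  then have "2 * (m + 2) + (m + 1) * m \<le> 2 * card E" using e m by simp
  then have "g.co.darts E V + 4 \<le> 2 * card V" using c(4) unfolding m by (simp add: algebra_simps)
  then show ?thesis
    using g.diameter_two[OF c(1)] by (intro rainbow_mvc[OF c(1)]) blast
qed

text \<open>Either the diameter is at most two, or an edge dominates the graph and its two ends share a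
  colour.\<close>

lemma mvc_ge_card_minus_1:
  assumes G: "connected_graph V E" and n: "4 \<le> card V"
    and e: "card V - 1 + ((card V - 3) choose 2) \<le> card E"
  shows "card V - 1 \<le> mvc V E"
proof -
  note c = connected_darts[OF G]
  obtain m where m: "card V = m + 4" using n le_Suc_ex by (metis add.commute)
  have "2 * ((m + 1) choose 2) = (m + 1) * m" using twice_choose_two[of "m + 1"] by simp
  then have "2 * (m + 3) + (m + 1) * m \<le> 2 * card E" using e m by simp
  then have sparse: "g.co.darts E V + 10 \<le> 4 * card V"
    using c(4) unfolding m by (simp add: algebra_simps)
  show ?thesis
  proof (cases "\<exists>a\<in>V. \<exists>b\<in>V. a \<noteq> b \<and> \<not> edge_rel E a b \<and> (\<forall>w\<in>V. edge_rel E a w \<longrightarrow> \<not> edge_rel E b w)")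
    case False
    then have "card V \<le> mvc V E" by (intro rainbow_mvc[OF c(1)]) blast
    then show ?thesis by simp
  next
    case True
    then obtain a b where ab: "a \<in> V" "b \<in> V" "a \<noteq> b" "\<not> edge_rel E a b"
      and no: "\<And>w. w \<in> V \<Longrightarrow> edge_rel E a w \<Longrightarrow> \<not> edge_rel E b w" by blast
    obtain x y where xy: "x \<in> V" "y \<in> V" "edge_rel E x y"
      "V - {x, y} \<subseteq> g.boundary E V {x, y}"
      by (rule g.dominating_edge[OF c(1,2) sparse ab no])
    have "card V \<le> card (V - {x, y}) + card {x, y}"
      using diff_card_le_card_Diff[of "{x, y}" V] by simp
    then have "card V \<le> card (V - {x, y}) + 2"
      using card_insert_le_m1[of 2 "{y}" x] by simp
    moreover have "card (V - {x, y}) \<le> card (g.boundary E V {x, y})"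
      by (rule card_mono[OF g.finite_boundary[OF c(1)] xy(4)])
    moreover have "card (g.boundary E V {x, y}) + 1 \<le> mvc V E"
      using boundary_mvc[OF G g.linked_pair[OF xy(3)]] xy by blast
    ultimately show ?thesis by linarith
  qed
qed


section \<open>Extremal graphs\<close>

lemma (in adjacency) linked_attach:
  assumes "finite W" "linked D" "\<And>v. v \<in> W \<Longrightarrow> \<exists>u\<in>D. adj u v"
  shows "linked (D \<union> W)"
  using assms
proof (induction W rule: finite_induct)
  case (insert v W)
  then obtain u where "u \<in> D" "adj u v" by blast
  moreover have "linked (D \<union> W)" using insert by blast
  ultimately show ?case using linked_insert[of "D \<union> W" u v] by simp
qed simp

text \<open>Vertices \<open>0, \<dots>, q - 1\<close> form a path without the edge from \<open>0\<close>
  to \<open>1\<close>, and the \<open>w\<close> vertices from \<open>q\<close> on form a clique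
  that is joined completely to \<open>0\<close> and to \<open>q - 1\<close>. Starting at
  \<open>0\<close>, one passes the clique, then \<open>q - 1\<close>, and goes down to
  \<open>1\<close>, a distance of \<open>q\<close>.\<close>

definition open_necklace :: "nat \<Rightarrow> nat \<Rightarrow> nat set set" where
  "open_necklace q w =
     (\<lambda>i. {i, Suc i}) ` {1..<q - 1} \<union> (\<lambda>v. {q - 1, v}) ` {q..<q + w} \<union>
     (\<lambda>v. {0, v}) ` {q..<q + w} \<union> {e. e \<subseteq> {q..<q + w} \<and> card e = 2}"

text \<open>The missing edge turns the graph into a cycle of length \<open>q + 1\<close> one vertex of
  which is replaced by the clique.\<close>

definition closed_necklace :: "nat \<Rightarrow> nat \<Rightarrow> nat set set" where
  "closed_necklace q w = insert {0, 1} (open_necklace q w)"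

lemma open_necklace_adjacent:
  assumes "{a, b} \<in> open_necklace q w" "3 \<le> q"
  shows "a < q + w \<and> b < q + w \<and> a \<noteq> b \<and>
    (1 \<le> a \<and> b = Suc a \<and> b < q \<or> 1 \<le> b \<and> a = Suc b \<and> a < q \<or>
     a = q - 1 \<and> q \<le> b \<or> b = q - 1 \<and> q \<le> a \<or> a = 0 \<and> q \<le> b \<or> b = 0 \<and> q \<le> a \<or> q \<le> a \<and> q \<le> b)"
proof -
  consider i where "i \<in> {1..<q - 1}" "{a, b} = {i, Suc i}" | v where "v \<in> {q..<q + w}" "{a, b} = {q - 1, v}"
    | v where "v \<in> {q..<q + w}" "{a, b} = {0, v}" | "{a, b} \<subseteq> {q..<q + w}" "card {a, b} = 2"
    using assms(1) unfolding open_necklace_def by blast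
  then show ?thesis
  proof cases
    case 4
    then have "a \<noteq> b" by auto
    then show ?thesis using 4 by auto
  qed (use assms(2) in \<open>auto simp: doubleton_eq_iff\<close>)
qed

lemma closed_necklace_adjacent:
  assumes "{a, b} \<in> closed_necklace q w" "3 \<le> q"
  shows "a < q + w \<and> b < q + w \<and> a \<noteq> b \<and>
    (b = Suc a \<and> b < q \<or> a = Suc b \<and> a < q \<or>
     a = q - 1 \<and> q \<le> b \<or> b = q - 1 \<and> q \<le> a \<or> a = 0 \<and> q \<le> b \<or> b = 0 \<and> q \<le> a \<or> q \<le> a \<and> q \<le> b)"
proof (cases "{a, b} = {0, 1}")
  case True
  then show ?thesis using assms(2) by (auto simp: doubleton_eq_iff)
next
  case False
  then have "{a, b} \<in> open_necklace q w" using assms(1) unfolding closed_necklace_def by simp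
  from open_necklace_adjacent[OF this assms(2)] show ?thesis by auto
qed

lemma card_open_necklace:
  assumes "3 \<le> q"
  shows "card (open_necklace q w) = q - 2 + w + (Suc w choose 2)"
proof -
  let ?W = "{q..<q + w}"
  let ?P = "(\<lambda>i. {i, Suc i}) ` {1..<q - 1}" and ?Q = "(\<lambda>v. {q - 1, v}) ` ?W"
    and ?R = "(\<lambda>v. {0, v}) ` ?W" and ?Z = "{e. e \<subseteq> ?W \<and> card e = 2}"
  have "card ?P = q - 2"
    by (subst card_image) (auto simp: inj_on_def doubleton_eq_iff)
  moreover have "card ?Q = w"
    by (subst card_image) (auto simp: inj_on_def doubleton_eq_iff)
  moreover have "card ?R = w"
    by (subst card_image) (auto simp: inj_on_def doubleton_eq_iff)
  moreover have Z: "card ?Z = w choose 2" using n_subsets[of ?W 2] by simp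
  moreover have "finite ?Z" by simp
  moreover have "?P \<inter> ?Q = {}" "(?P \<union> ?Q) \<inter> ?R = {}" "(?P \<union> ?Q \<union> ?R) \<inter> ?Z = {}"
    using assms by (auto simp: doubleton_eq_iff)
  ultimately have "card (?P \<union> ?Q \<union> ?R \<union> ?Z) = (q - 2) + w + w + (w choose 2)"
    by (subst card_Un_disjoint; simp)+
  moreover have "Suc w choose 2 = w + (w choose 2)"
    by (simp add: numeral_2_eq_2)
  ultimately show ?thesis unfolding open_necklace_def by simp
qed

lemma finite_open_necklace: "finite (open_necklace q w)"
  unfolding open_necklace_def by simp

lemma card_closed_necklace:
  assumes "3 \<le> q"
  shows "card (closed_necklace q w) = q - 1 + w + (Suc w choose 2)"
proof -
  have "{0, 1} \<notin> open_necklace q w" using open_necklace_adjacent[OF _ assms, of 0 1 w] assms by auto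
  then show ?thesis
    unfolding closed_necklace_def using card_open_necklace[OF assms, of w] finite_open_necklace assms by simp
qed

lemma necklace_connected:
  assumes "3 \<le> q" "1 \<le> w" and E: "E = open_necklace q w \<or> E = closed_necklace q w"
  shows "connected_graph {0..<q + w} E"
proof (rule linked_imp_connected)
  have sub: "open_necklace q w \<subseteq> E" "E \<subseteq> closed_necklace q w"
    using E unfolding closed_necklace_def by auto
  show "simple_graph {0..<q + w} E"
  proof -
    have "e \<subseteq> {0..<q + w} \<and> card e = 2" if "e \<in> closed_necklace q w" for e
      using that assms(1) unfolding closed_necklace_def open_necklace_def by auto
    then show ?thesis unfolding simple_graph_def using sub by blast
  qed
  have e: "edge_rel E a b" if "{a, b} \<in> open_necklace q w" for a b
    using that sub open_necklace_adjacent[OF that assms(1)] unfolding edge_rel_def by blast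
  have path: "g.linked E {1..<Suc m}" if "1 \<le> m" "m < q" for m
    using that
  proof (induction m)
    case (Suc m)
    show ?case
    proof (cases "m = 0")
      case True
      then have "{1..<Suc (Suc m)} = {1}" by auto
      then show ?thesis using g.linked_singleton by simp
    next
      case False
      then have "{m, Suc m} \<in> open_necklace q w" using Suc.prems unfolding open_necklace_def by auto
      then have "edge_rel E m (Suc m)" by (rule e)
      moreover have "g.linked E {1..<Suc m}" "m \<in> {1..<Suc m}" using False Suc by auto
      ultimately have "g.linked E (insert (Suc m) {1..<Suc m})" by (intro g.linked_insert[of E _ m])
      moreover have "{1..<Suc (Suc m)} = insert (Suc m) {1..<Suc m}" by auto
      ultimately show ?thesis by simp
    qed
  qed simp
  have "g.linked E ({1..<q} \<union> {q..<q + w})"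
  proof (rule g.linked_attach)
    show "g.linked E {1..<q}" using path[of "q - 1"] assms(1) by simp
    show "\<exists>u\<in>{1..<q}. edge_rel E u v" if v: "v \<in> {q..<q + w}" for v
    proof -
      have "{q - 1, v} \<in> open_necklace q w" using v unfolding open_necklace_def by blast
      moreover have "q - 1 \<in> {1..<q}" using assms(1) by auto
      ultimately show ?thesis using e by blast
    qed
  qed simp
  moreover have "{0, q} \<in> open_necklace q w" using assms(2) unfolding open_necklace_def by auto
  then have "edge_rel E q 0" using e[of 0 q] g.adj_sym[of E 0 q] by blast
  moreover have "q \<in> {1..<q} \<union> {q..<q + w}" using assms(2) by auto
  ultimately have "g.linked E (insert 0 ({1..<q} \<union> {q..<q + w}))" by (intro g.linked_insert[of E _ q])
  moreover have "insert 0 ({1..<q} \<union> {q..<q + w}) = {0..<q + w}" using assms(1) by auto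
  ultimately show "g.linked E {0..<q + w}" by simp
qed

text \<open>The colour \<open>\<kappa>\<close> of the internal vertices of a monochromatic path from
  \<open>u\<close> to \<open>v\<close> shows up behind every cut between \<open>u\<close> and
  \<open>v\<close>, unless the path crosses it with its last edge. This is all that is needed
  about paths in the extremal graphs.\<close>

lemma monochromatic_cut:
  assumes c: "MVC_coloring V E c" and uv: "u \<in> V" "v \<in> V"
  shows "\<exists>\<kappa>. \<forall>S. u \<in> S \<longrightarrow> v \<notin> S \<longrightarrow>
    (\<exists>a b. a \<in> S \<and> b \<notin> S \<and> {a, b} \<in> E \<and> (b = v \<or> c b = \<kappa>))"
proof -
  obtain p where p: "path_between V E u p v" "vertex_monochromatic c p"
    using c uv unfolding MVC_coloring_def by blast
  obtain \<kappa> where k: "\<And>x. x \<in> internal_vertices p \<Longrightarrow> c x = \<kappa>"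
    using p(2) unfolding vertex_monochromatic_def by blast
  have "\<exists>a b. a \<in> S \<and> b \<notin> S \<and> {a, b} \<in> E \<and> (b = v \<or> c b = \<kappa>)" if S: "u \<in> S" "v \<notin> S" for S
  proof -
    obtain a b where ab: "a \<in> S" "b \<notin> S" "{a, b} \<in> E" "b \<in> set p"
      by (rule path_exit[OF p(1) S])
    then have "b = v \<or> b \<in> internal_vertices p" using set_path_subset[OF p(1)] S by blast
    then show ?thesis using ab k by blast
  qed
  then show ?thesis by blast
qed

lemma card_image_two_more:
  assumes "finite W" "c ` V \<subseteq> c ` W \<union> {x, y}"
  shows "card (c ` V) \<le> card W + 2"
proof -
  have "card (c ` V) \<le> card (c ` W \<union> {x, y})" using assms by (intro card_mono) auto
  also have "\<dots> \<le> card (c ` W) + card {x, y}" by (rule card_Un_le)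
  also have "\<dots> \<le> card W + 2"
    using card_image_le[OF assms(1), of c] card_insert_le_m1[of 2 "{y}" x] by simp
  finally show ?thesis .
qed

text \<open>The path from \<open>0\<close> to \<open>1\<close> runs through a vertex of the clique and all
  of \<open>q - 1, \<dots>, 2\<close>. So these have a colour of the clique, and only
  \<open>0\<close> and \<open>1\<close> can contribute further colours.\<close>

lemma mvc_open_necklace:
  assumes q: "3 \<le> q" and w: "1 \<le> w"
  shows "mvc {0..<q + w} (open_necklace q w) \<le> w + 2"
proof (rule mvc_le[OF necklace_connected[OF q w]])
  fix c :: "nat \<Rightarrow> nat"
  let ?V = "{0..<q + w}" and ?W = "{q..<q + w}"
  assume c: "MVC_coloring ?V (open_necklace q w) c"
  have V01: "0 \<in> ?V" "1 \<in> ?V" using q by auto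
  obtain \<kappa> where "\<forall>S. 0 \<in> S \<longrightarrow> 1 \<notin> S \<longrightarrow>
    (\<exists>a b. a \<in> S \<and> b \<notin> S \<and> {a, b} \<in> open_necklace q w \<and> (b = 1 \<or> c b = \<kappa>))"
    using monochromatic_cut[OF c V01] by blast
  note cut = this[rule_format]
  obtain b where "{0, b} \<in> open_necklace q w" "b = 1 \<or> c b = \<kappa>"
    using cut[of "{0}"] by auto
  then have k: "\<kappa> \<in> c ` ?W"
    using open_necklace_adjacent[OF _ q, of 0 b w] q by auto
  have mid: "c i = \<kappa>" if i: "2 \<le> i" "i < q" for i
  proof -
    obtain a b where ab: "a = 0 \<or> i < a" "\<not> (b = 0 \<or> i < b)" "{a, b} \<in> open_necklace q w"
      "b = 1 \<or> c b = \<kappa>"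
      using cut[of "{v. v = 0 \<or> i < v}"] i by auto
    have "b = i" using open_necklace_adjacent[OF ab(3) q] ab(1,2) i by auto
    then show ?thesis using ab(4) i by simp
  qed
  have "c ` ?V \<subseteq> c ` ?W \<union> {c 0, c 1}"
  proof
    fix x assume "x \<in> c ` ?V"
    then obtain v where v: "v < q + w" "x = c v" by auto
    consider "v = 0" | "v = 1" | "2 \<le> v" "v < q" | "q \<le> v" by linarith
    then show "x \<in> c ` ?W \<union> {c 0, c 1}"
      by cases (use v mid k in auto)
  qed
  then show "card (c ` ?V) \<le> w + 2" using card_image_two_more[of ?W c ?V] by simp
qed simp

text \<open>A monochromatic path between a vertex of the clique and a vertex \<open>i\<close> of the path
  makes one of the two arcs from the clique to \<open>i\<close> monochromatic. Therefore the
  path consists of an initial run with the colour of \<open>0\<close>, two arbitrary vertices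
  \<open>s\<close> and \<open>s + 1\<close>, and a final run with the colour of
  \<open>q - 1\<close>. One of the runs has at least two vertices because
  \<open>q \<ge> 5\<close>. The two pairs at distance three around \<open>s\<close> that reach
  into this run then force two coincidences among the four colours and those of the clique.\<close>

lemma mvc_closed_necklace:
  assumes q: "5 \<le> q" and w: "1 \<le> w"
  shows "mvc {0..<q + w} (closed_necklace q w) \<le> w + 2"
proof (rule mvc_le[OF necklace_connected[OF _ w]])
  fix c :: "nat \<Rightarrow> nat"
  let ?V = "{0..<q + w}" and ?W = "{q..<q + w}" and ?E = "closed_necklace q w"
  assume c: "MVC_coloring ?V ?E c"
  have q3: "3 \<le> q" using q by simp
  note nbr = closed_necklace_adjacent[OF _ q3, of _ _ w]
  define pre where "pre i \<longleftrightarrow> (\<forall>x<i. c x = c 0)" for i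
  define suf where "suf i \<longleftrightarrow> (\<forall>y. i < y \<and> y < q \<longrightarrow> c y = c (q - 1))" for i
  have ends: "pre i \<or> suf i" if i: "1 \<le> i" "i + 2 \<le> q" for i
  proof -
    have iq: "i \<in> ?V" "q \<in> ?V" using i w by auto
    obtain \<kappa> where "\<forall>S. i \<in> S \<longrightarrow> q \<notin> S \<longrightarrow>
      (\<exists>a b. a \<in> S \<and> b \<notin> S \<and> {a, b} \<in> ?E \<and> (b = q \<or> c b = \<kappa>))"
      using monochromatic_cut[OF c iq] by blast
    note cut = this[rule_format]
    have "c x = \<kappa> \<or> c y = \<kappa>" if xy: "x < i" "i < y" "y < q" for x y
    proof -
      obtain a b where ab: "x < a" "a < y" "\<not> (x < b \<and> b < y)" "{a, b} \<in> ?E" "b = q \<or> c b = \<kappa>"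
        using cut[of "{x<..<y}"] xy by auto
      have "b = x \<or> b = y" using nbr[OF ab(4)] ab(1-3) xy by auto
      then show ?thesis using ab(5) xy by auto
    qed
    then have "(\<forall>x<i. c x = \<kappa>) \<or> (\<forall>y. i < y \<and> y < q \<longrightarrow> c y = \<kappa>)" by blast
    then show ?thesis
    proof
      assume "\<forall>x<i. c x = \<kappa>"
      then show ?thesis unfolding pre_def using i by auto
    next
      assume "\<forall>y. i < y \<and> y < q \<longrightarrow> c y = \<kappa>"
      moreover have "i < q - 1 \<and> q - 1 < q" using i by auto
      ultimately show ?thesis unfolding suf_def by metis
    qed
  qed
  have arcs: "(\<exists>\<kappa>. \<forall>x. i < x \<and> x < j \<longrightarrow> c x = \<kappa>) \<or>
      (\<forall>y<i. c y \<in> c ` ?W) \<and> (\<forall>y. j < y \<and> y < q \<longrightarrow> c y \<in> c ` ?W)"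
    if ij: "i < j" "j < q" for i j
  proof -
    have ijV: "i \<in> ?V" "j \<in> ?V" using ij by auto
    obtain \<kappa> where "\<forall>S. i \<in> S \<longrightarrow> j \<notin> S \<longrightarrow>
      (\<exists>a b. a \<in> S \<and> b \<notin> S \<and> {a, b} \<in> ?E \<and> (b = j \<or> c b = \<kappa>))"
      using monochromatic_cut[OF c ijV] by blast
    note cut = this[rule_format]
    show ?thesis
    proof (cases "\<forall>x. i < x \<and> x < j \<longrightarrow> c x = \<kappa>")
      case False
      then obtain x where x: "i < x" "x < j" "c x \<noteq> \<kappa>" by blast
      have below: "c y = \<kappa>" if y: "y < i" for y
      proof -
        obtain a b where ab: "y < a" "a < x" "\<not> (y < b \<and> b < x)" "{a, b} \<in> ?E" "b = j \<or> c b = \<kappa>"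
          using cut[of "{y<..<x}"] x y by auto
        have "b = x \<or> b = y" using nbr[OF ab(4)] ab(1-3) x y ij by auto
        then show ?thesis using ab(5) x y by auto
      qed
      have above: "c y = \<kappa>" if y: "j < y" "y < q" for y
      proof -
        obtain a b where ab: "\<not> (x \<le> a \<and> a \<le> y)" "x \<le> b" "b \<le> y" "{a, b} \<in> ?E" "b = j \<or> c b = \<kappa>"
          using cut[of "- {x..y}"] x y by auto
        have "b = x \<or> b = y" using nbr[OF ab(4)] ab(1-3) x y ij by auto
        then show ?thesis using ab(5) x y by auto
      qed
      have "\<kappa> \<in> c ` ?W"
      proof -
        obtain a b where ab: "a < x" "\<not> b < x" "{a, b} \<in> ?E" "b = j \<or> c b = \<kappa>"
          using cut[of "{..<x}"] x by auto
        have "b = x \<or> b \<in> ?W" using nbr[OF ab(3)] ab(1,2) x ij by auto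
        then show ?thesis using ab(4) x ij by auto
      qed
      then show ?thesis using below above by auto
    qed blast
  qed
  \<comment> \<open>The least admissible \<open>s\<close> has a monochromatic initial run: otherwise \<open>ends\<close> would make \<open>s - 1\<close>
    admissible.\<close>
  define s where "s = (LEAST s. 1 \<le> s \<and> suf (s + 1))"
  have sq: "1 \<le> q - 3 \<and> suf (q - 3 + 1)"
  proof -
    have "y = q - 1" if "q - 3 + 1 < y" "y < q" for y using that q by linarith
    then show ?thesis unfolding suf_def using q by auto
  qed
  have s: "1 \<le> s" "suf (s + 1)" "s \<le> q - 3"
    unfolding s_def using LeastI[of "\<lambda>s. 1 \<le> s \<and> suf (s + 1)", OF sq]
      Least_le[of "\<lambda>s. 1 \<le> s \<and> suf (s + 1)", OF sq] by auto
  have "pre s"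
  proof (cases "s = 1")
    case True
    then show ?thesis unfolding pre_def by simp
  next
    case False
    have "\<not> (1 \<le> s - 1 \<and> suf (s - 1 + 1))"
      using not_less_Least[of "s - 1" "\<lambda>s. 1 \<le> s \<and> suf (s + 1)"] s(1) unfolding s_def[symmetric] by simp
    then have "\<not> suf s" using False s(1) by simp
    then show ?thesis using ends[of s] s q by auto
  qed
  then have low: "c x = c 0" if "x < s" for x using that unfolding pre_def by blast
  have high: "c y = c (q - 1)" if "s + 1 < y" "y < q" for y using that s(2) unfolding suf_def by blast
  have middle: "c s = c (s + 1) \<or> (2 \<le> s \<longrightarrow> c 0 \<in> c ` ?W) \<and> (s + 3 < q \<longrightarrow> c (q - 1) \<in> c ` ?W)"
  proof -
    have "s - 1 < s + 2" "s + 2 < q" using s q by auto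
    from arcs[OF this] show ?thesis
    proof
      assume "\<exists>\<kappa>. \<forall>x. s - 1 < x \<and> x < s + 2 \<longrightarrow> c x = \<kappa>"
      then obtain \<kappa> where "\<forall>x. s - 1 < x \<and> x < s + 2 \<longrightarrow> c x = \<kappa>" by blast
      then have "c s = \<kappa>" "c (s + 1) = \<kappa>" using s(1) by auto
      then show ?thesis by simp
    next
      assume "(\<forall>y<s - 1. c y \<in> c ` ?W) \<and> (\<forall>y. s + 2 < y \<and> y < q \<longrightarrow> c y \<in> c ` ?W)"
      moreover have "2 \<le> s \<longrightarrow> 0 < s - 1" "s + 3 < q \<longrightarrow> s + 2 < q - 1 \<and> q - 1 < q" by auto
      ultimately show ?thesis by blast
    qed
  qed
  have left: "c 0 = c s \<or> c (q - 1) \<in> c ` ?W" if s2: "2 \<le> s"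
  proof -
    have "s - 2 < s + 1" "s + 1 < q" using s q by auto
    from arcs[OF this] show ?thesis
    proof
      assume "\<exists>\<kappa>. \<forall>x. s - 2 < x \<and> x < s + 1 \<longrightarrow> c x = \<kappa>"
      then obtain \<kappa> where "\<forall>x. s - 2 < x \<and> x < s + 1 \<longrightarrow> c x = \<kappa>" by blast
      moreover have "s - 2 < s - 1 \<and> s - 1 < s + 1" "s - 2 < s \<and> s < s + 1" using s2 by auto
      ultimately have "c (s - 1) = \<kappa>" "c s = \<kappa>" by blast+
      then show ?thesis using low[of "s - 1"] s2 by simp
    next
      assume "(\<forall>y<s - 2. c y \<in> c ` ?W) \<and> (\<forall>y. s + 1 < y \<and> y < q \<longrightarrow> c y \<in> c ` ?W)"
      moreover have "s + 1 < q - 1 \<and> q - 1 < q" using s q by auto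
      ultimately show ?thesis by blast
    qed
  qed
  have right: "c (q - 1) = c (s + 1) \<or> c 0 \<in> c ` ?W" if s3: "s + 3 < q"
  proof -
    have "s < s + 3" by simp
    from arcs[OF this s3] show ?thesis
    proof
      assume "\<exists>\<kappa>. \<forall>x. s < x \<and> x < s + 3 \<longrightarrow> c x = \<kappa>"
      then obtain \<kappa> where "\<forall>x. s < x \<and> x < s + 3 \<longrightarrow> c x = \<kappa>" by blast
      then have "c (s + 1) = \<kappa>" "c (s + 2) = \<kappa>" by auto
      then show ?thesis using high[of "s + 2"] s3 by simp
    next
      assume "(\<forall>y<s. c y \<in> c ` ?W) \<and> (\<forall>y. s + 3 < y \<and> y < q \<longrightarrow> c y \<in> c ` ?W)"
      then show ?thesis using s(1) by auto
    qed
  qed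
  have cover: "c ` ?V \<subseteq> c ` ?W \<union> {c 0, c (q - 1), c s, c (s + 1)}"
  proof
    fix x assume "x \<in> c ` ?V"
    then obtain v where v: "v < q + w" "x = c v" by auto
    consider "v < s" | "v = s" | "v = s + 1" | "s + 1 < v" "v < q" | "q \<le> v" by linarith
    then show "x \<in> c ` ?W \<union> {c 0, c (q - 1), c s, c (s + 1)}"
    proof cases
      case 1
      then have "x = c 0" using v(2) low[of v] by metis
      then show ?thesis by simp
    next
      case 4
      then have "x = c (q - 1)" using v(2) high[of v] by metis
      then show ?thesis by simp
    qed (use v in auto)
  qed
  have "\<exists>x y. c ` ?V \<subseteq> c ` ?W \<union> {x, y}"
  proof (cases "2 \<le> s")
    case True
    consider "c s = c (s + 1)" "c 0 = c s" | "c s = c (s + 1)" "c (q - 1) \<in> c ` ?W"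
      | "c 0 \<in> c ` ?W" "c 0 = c s" | "c 0 \<in> c ` ?W" "c (q - 1) \<in> c ` ?W"
      using middle left[OF True] True by blast
    then show ?thesis
    proof cases
      case 1
      then have "c ` ?V \<subseteq> c ` ?W \<union> {c 0, c (q - 1)}" using cover by auto
      then show ?thesis by blast
    next
      case 2
      then have "c ` ?V \<subseteq> c ` ?W \<union> {c 0, c s}" using cover by auto
      then show ?thesis by blast
    next
      case 3
      then have "c ` ?V \<subseteq> c ` ?W \<union> {c (q - 1), c (s + 1)}" using cover by auto
      then show ?thesis by blast
    next
      case 4
      then have "c ` ?V \<subseteq> c ` ?W \<union> {c s, c (s + 1)}" using cover by auto
      then show ?thesis by blast
    qed
  next
    case False
    then have s3: "s + 3 < q" using s q by linarith
    consider "c s = c (s + 1)" "c (q - 1) = c (s + 1)" | "c s = c (s + 1)" "c 0 \<in> c ` ?W"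
      | "c (q - 1) \<in> c ` ?W" "c (q - 1) = c (s + 1)" | "c (q - 1) \<in> c ` ?W" "c 0 \<in> c ` ?W"
      using middle right[OF s3] s3 by blast
    then show ?thesis
    proof cases
      case 1
      then have "c ` ?V \<subseteq> c ` ?W \<union> {c 0, c (q - 1)}" using cover by auto
      then show ?thesis by blast
    next
      case 2
      then have "c ` ?V \<subseteq> c ` ?W \<union> {c (q - 1), c s}" using cover by auto
      then show ?thesis by blast
    next
      case 3
      then have "c ` ?V \<subseteq> c ` ?W \<union> {c 0, c s}" using cover by auto
      then show ?thesis by blast
    next
      case 4
      then have "c ` ?V \<subseteq> c ` ?W \<union> {c s, c (s + 1)}" using cover by auto
      then show ?thesis by blast
    qed
  qed
  then show "card (c ` ?V) \<le> w + 2" using card_image_two_more[of ?W c ?V] by auto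
qed (use q in auto)

section \<open>The values of the extremal function\<close>

text \<open>The lower bound needs a graph only if the claimed value exceeds \<open>n - 1\<close>, the
  smallest value admitted in the definition.\<close>

lemma f_v_eqI:
  assumes "n - 1 \<le> f"
    and upper: "\<And>(V :: nat set) E. connected_graph V E \<Longrightarrow> card V = n \<Longrightarrow> f \<le> card E \<Longrightarrow> k \<le> mvc V E"
    and lower: "f = n - 1 \<or> (\<exists>(V :: nat set) E. connected_graph V E \<and> card V = n \<and> f \<le> card E + 1 \<and> mvc V E < k)"
  shows "f_v n k = f"
  unfolding f_v_def
proof (rule Least_equality)
  fix y assume y: "n - 1 \<le> y \<and>
    (\<forall>(V :: nat set) E. connected_graph V E \<and> card V = n \<and> y \<le> card E \<longrightarrow> k \<le> mvc V E)"
  show "f \<le> y"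
  proof (rule ccontr)
    assume "\<not> f \<le> y"
    then obtain V :: "nat set" and E where G: "connected_graph V E" "card V = n" "f \<le> card E + 1" "mvc V E < k"
      using y lower by auto
    then have "y \<le> card E" using \<open>\<not> f \<le> y\<close> by linarith
    then show False using y G by fastforce
  qed
qed (use assms in blast)

theorem corollary3p7:
  fixes n k :: nat
  assumes "3 \<le> k" and "k \<le> n"
  shows "(k = 3 \<longrightarrow> f_v n k = n - 1) \<and>
         (4 \<le> k \<and> k \<le> n - 2 \<longrightarrow> f_v n k = n + ((k - 2) choose 2)) \<and>
         (n - 1 \<le> k \<and> k \<le> n \<longrightarrow> f_v n k = n - 1 + ((k - 2) choose 2))"
proof -
  have three: "f_v n k = n - 1" if "k = 3"
    using that assms mvc_ge_3 by (intro f_v_eqI) auto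
  define q w where "q = n - k + 3" and "w = k - 3"
  have qw: "3 \<le> q" "q + w = n" "k = w + 3" "Suc w = k - 2" using assms unfolding q_def w_def by auto
  have middle: "f_v n k = n + ((k - 2) choose 2)" if k: "4 \<le> k" "k \<le> n - 2"
  proof (rule f_v_eqI)
    have wq: "1 \<le> w" "5 \<le> q" using k assms unfolding q_def w_def by auto
    have "connected_graph {0..<n} (closed_necklace q w)"
      using necklace_connected[OF qw(1) wq(1)] qw(2) by metis
    moreover have "mvc {0..<n} (closed_necklace q w) < k"
      using mvc_closed_necklace[OF wq(2,1)] unfolding qw(2) qw(3) by linarith
    moreover have "n + ((k - 2) choose 2) \<le> card (closed_necklace q w) + 1"
      using card_closed_necklace[OF qw(1), of w] qw(1,2) unfolding qw(4) by linarith
    ultimately show "n + ((k - 2) choose 2) = n - 1 \<or>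
      (\<exists>(V :: nat set) E. connected_graph V E \<and> card V = n \<and>
         n + ((k - 2) choose 2) \<le> card E + 1 \<and> mvc V E < k)"
      by (metis card_atLeastLessThan diff_zero)
    show "k \<le> mvc V E" if G: "connected_graph V E" "card V = n" "n + ((k - 2) choose 2) \<le> card E"
      for V :: "nat set" and E
    proof -
      have "k + 1 \<le> card V" using k G(2) by linarith
      then show ?thesis using mvc_ge_general[OF G(1) k(1)] G by simp
    qed
  qed simp
  have top: "f_v n k = n - 1 + ((k - 2) choose 2)" if k: "n - 1 \<le> k" "k \<le> n" "k \<noteq> 3"
  proof (rule f_v_eqI)
    have w: "1 \<le> w" using k assms unfolding w_def by auto
    have "connected_graph {0..<n} (open_necklace q w)"
      using necklace_connected[OF qw(1) w] qw(2) by metis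
    moreover have "mvc {0..<n} (open_necklace q w) < k"
      using mvc_open_necklace[OF qw(1) w] unfolding qw(2) qw(3) by linarith
    moreover have "n - 1 + ((k - 2) choose 2) \<le> card (open_necklace q w) + 1"
      using card_open_necklace[OF qw(1), of w] qw(1,2) unfolding qw(4) by linarith
    ultimately show "n - 1 + ((k - 2) choose 2) = n - 1 \<or>
      (\<exists>(V :: nat set) E. connected_graph V E \<and> card V = n \<and>
         n - 1 + ((k - 2) choose 2) \<le> card E + 1 \<and> mvc V E < k)"
      by (metis card_atLeastLessThan diff_zero)
    show "k \<le> mvc V E" if G: "connected_graph V E" "card V = n" "n - 1 + ((k - 2) choose 2) \<le> card E"
      for V :: "nat set" and E
    proof (cases "k = n")
      case True
      then show ?thesis using mvc_ge_card[OF G(1)] G assms by simp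
    next
      case False
      then have "k = n - 1" "4 \<le> n" "k - 2 = n - 3" using k assms by auto
      then show ?thesis using mvc_ge_card_minus_1[OF G(1)] G by simp
    qed
  qed simp
  show ?thesis using three middle top by (cases "k = 3") (simp_all add: binomial_eq_0)
qed

end
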